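(* Let $\mathcal{H}$ be an infinite-dimensional separable real Hilbert space, let $(e_k)_{k\in\mathbb{N}}$ (with $\mathbb{N}=\{0,1,2,\dots\}$) be an orthonormal basis of $\mathcal{H}$, let $V=\{e_0\}^\perp$, and let $K$ be the smallest closed convex cone containing the set $$\Big\{\exp(-100\xi^3)\,e_0+\cos\big(\pi(\xi-\lfloor\xi\rfloor)/2\big)\,e_{\lfloor\xi\rfloor+1}+\sin\big(\pi(\xi-\lfloor\xi\rfloor)/2\big)\,e_{\lfloor\xi\rfloor+2}\ \Big|\ \xi\in[0,+\infty[\Big\}.$$ Let $\mathrm{proj}_V$, $\mathrm{proj}_{V^\perp}$ and $\mathrm{proj}_K$ be the projection operators onto $V$, $V^\perp$ and $K$, and define the set-valued operator $B\colon\mathcal{H}\to 2^{\mathcal{H}}$ by $$B=\big(\mathrm{proj}_V\circ\mathrm{proj}_K\circ\mathrm{proj}_V\big)^{-1}-\mathrm{Id}.$$ Set $x_0=e_2$ and $u_0=0$, and let $(x_n,u_n)_{n\in\mathbb{N}}$ be the sequence generated by the method of partial inverses $$(\forall n\in\mathbb{N})\quad x_{n+1}=\mathrm{proj}_V\big(J_B(x_n+u_n)\big)\quad\text{and}\quad u_{n+1}=\mathrm{proj}_{V^\perp}\big(J_{B^{-1}}(x_n+u_n)\big).$$ Then $(0,0)$ is a solution to the problem $$\text{find }x\in V\text{ and }u\in V^\perp\text{ such that }u\in Bx,$$ and the sequence $(x_n,u_n)_{n\in\mathbb{N}}$ converges weakly but not strongly to $(0,0)$.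
   Context: For a set-valued operator $M\colon\mathcal{H}\to 2^{\mathcal{H}}$, the inverse $M^{-1}$ is the set-valued operator defined by $x\in M^{-1}u\Leftrightarrow u\in Mx$; a single-valued map $T\colon\mathcal{H}\to\mathcal{H}$ is identified with the set-valued operator $x\mapsto\{Tx\}$. Thus, for $T=\mathrm{proj}_V\circ\mathrm{proj}_K\circ\mathrm{proj}_V$ and $B=T^{-1}-\mathrm{Id}$, $Bx=\{u-x\mid u\in\mathcal{H},\ Tu=x\}$ for every $x\in\mathcal{H}$. The resolvent of $M$ is $J_M=(\mathrm{Id}+M)^{-1}$; if $M$ is maximally monotone (i.e. $\langle x-y\mid u-v\rangle\geq 0$ whenever $u\in Mx$ and $v\in My$, and the graph of $M$ is not properly contained in the graph of another operator with this property), then $J_M$ and $J_{M^{-1}}$ are single-valued and defined on all of $\mathcal{H}$; the operator $B$ of the statement is maximally monotone. For a nonempty closed convex set $C\subset\mathcal{H}$, $\mathrm{proj}_C$ maps each point to its unique nearest point in $C$. $\lfloor\xi\rfloor$ denotes the integer part (floor) of $\xi$. Weak and strong convergence of $(x_n,u_n)_{n\in\mathbb{N}}$ are understood in the product Hilbert space $\mathcal{H}\times\mathcal{H}$. *)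

theory Defs
  imports "HOL-Analysis.Analysis"
begin

subsection \<open>Set-valued operators\<close>

definition setop_inverse :: "('a \<Rightarrow> 'a set) \<Rightarrow> 'a \<Rightarrow> 'a set"
  where "setop_inverse M u = {x. u \<in> M x}"

definition setop_of_map :: "('a \<Rightarrow> 'a) \<Rightarrow> 'a \<Rightarrow> 'a set"
  where "setop_of_map T x = {T x}"

definition setop_add :: "('a::plus \<Rightarrow> 'a set) \<Rightarrow> ('a \<Rightarrow> 'a set) \<Rightarrow> 'a \<Rightarrow> 'a set"
  where "setop_add M N x = {u + v | u v. u \<in> M x \<and> v \<in> N x}"

definition setop_diff :: "('a::minus \<Rightarrow> 'a set) \<Rightarrow> ('a \<Rightarrow> 'a set) \<Rightarrow> 'a \<Rightarrow> 'a set"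
  where "setop_diff M N x = {u - v | u v. u \<in> M x \<and> v \<in> N x}"

definition resolvent :: "('a::plus \<Rightarrow> 'a set) \<Rightarrow> 'a \<Rightarrow> 'a set"
  where "resolvent M = setop_inverse (setop_add (setop_of_map id) M)"

text \<open>The value of a resolvent as a point. It is unspecified at a point where the resolvent
  is not a singleton; for a maximally monotone operator there is no such point.\<close>

definition resolvent_map :: "('a::plus \<Rightarrow> 'a set) \<Rightarrow> 'a \<Rightarrow> 'a"
  where "resolvent_map M z = the_elem (resolvent M z)"

definition inclusion_solution ::
    "'a::real_inner set \<Rightarrow> ('a \<Rightarrow> 'a set) \<Rightarrow> 'a \<times> 'a \<Rightarrow> bool"
  where "inclusion_solution V B = (\<lambda>(x, u). x \<in> V \<and> u \<in> V\<^sup>\<bottom> \<and> u \<in> B x)"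

subsection \<open>Hilbert space notions\<close>

text \<open>The library's \<open>closest_point\<close> is restricted to Heine-Borel spaces, hence to finite
  dimension.\<close>

definition proj_on :: "'a::metric_space set \<Rightarrow> 'a \<Rightarrow> 'a"
  where "proj_on C x = (THE p. p \<in> C \<and> (\<forall>y\<in>C. dist x p \<le> dist x y))"

definition orthonormal_basis :: "(nat \<Rightarrow> 'a::real_inner) \<Rightarrow> bool"
  where "orthonormal_basis e \<longleftrightarrow>
    (\<forall>i j. e i \<bullet> e j = (if i = j then 1 else 0)) \<and> closure (span (range e)) = UNIV"

definition weakly_converges_to :: "(nat \<Rightarrow> 'a::real_inner) \<Rightarrow> 'a \<Rightarrow> bool"
  where "weakly_converges_to X l \<longleftrightarrow> (\<forall>y. (\<lambda>n. X n \<bullet> y) \<longlonglongrightarrow> l \<bullet> y)"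

subsection \<open>The cone and the operator\<close>

definition curve_point :: "(nat \<Rightarrow> 'a::real_vector) \<Rightarrow> real \<Rightarrow> 'a"
  where "curve_point e \<xi> =
    exp (- 100 * \<xi> ^ 3) *\<^sub>R e 0
    + cos (pi * (\<xi> - of_int \<lfloor>\<xi>\<rfloor>) / 2) *\<^sub>R e (nat \<lfloor>\<xi>\<rfloor> + 1)
    + sin (pi * (\<xi> - of_int \<lfloor>\<xi>\<rfloor>) / 2) *\<^sub>R e (nat \<lfloor>\<xi>\<rfloor> + 2)"

definition curve_cone :: "(nat \<Rightarrow> 'a::real_normed_vector) \<Rightarrow> 'a set"
  where "curve_cone e = (\<lambda>C. closed C \<and> convex_cone C) hull {curve_point e \<xi> | \<xi>. 0 \<le> \<xi>}"

definition proj_comp_operator :: "'a::real_normed_vector set \<Rightarrow> 'a set \<Rightarrow> 'a \<Rightarrow> 'a set"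
  where "proj_comp_operator V K =
    setop_diff (setop_inverse (setop_of_map (proj_on V \<circ> proj_on K \<circ> proj_on V)))
      (setop_of_map id)"

end

theory Submission
  imports Defs
begin

text \<open>The iteration reduces to \<open>x (n + 1) = T (x n)\<close> and \<open>u n = 0\<close>, where \<open>T\<close> projects successively
  onto \<open>V\<close>, \<open>K\<close> and \<open>V\<close>: these are alternating projections, as in Hundal's example. The iterates
  follow the curve from \<open>e (m + 1)\<close> to \<open>e (m + 2)\<close>. As the coefficient of \<open>e 0\<close> decays like
  \<open>exp (- 100 \<xi>\<^sup>3)\<close>, a step that advances by \<open>\<xi> - r\<close> costs only a fraction \<open>(\<xi> - r) / (30 m\<^sup>2)\<close> of the
  norm. Hence some power of \<open>T\<close> maps \<open>e (m + 1)\<close> to within \<open>1 / (12 m\<^sup>2)\<close> of \<open>e (m + 2)\<close>, and since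
  \<open>T\<close> is nonexpansive these summable errors add up to at most \<open>1 / 6\<close>, so the norms stay above
  \<open>5 / 6\<close>. Weak convergence holds because each coordinate of a point of \<open>K\<close> is bounded by a constant
  multiple of its \<open>e 0\<close> coordinate, which tends to \<open>0\<close> along the projections onto \<open>K\<close>.\<close>

section \<open>Projections and resolvents\<close>

text \<open>By the parallelogram identity every minimizing sequence in \<open>C\<close> is Cauchy;
  completeness gives a limit, which attains the infimum \<open>d\<close>.\<close>

lemma nearest_point_exists:
  fixes C :: "'a::{real_inner, complete_space} set"
  assumes "closed C" "convex C" "C \<noteq> {}"
  shows "\<exists>p\<in>C. \<forall>y\<in>C. dist x p \<le> dist x y"
proof -
  define d where "d = infdist x C"
  have d0: "0 \<le> d" by (simp add: d_def infdist_nonneg)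
  have d_le: "d \<le> dist x y" if "y \<in> C" for y
    using that by (simp add: d_def infdist_le)
  have "\<exists>y\<in>C. dist x y < d + 1 / real (Suc n)" for n
  proof (rule ccontr)
    assume "\<not> ?thesis"
    then have "d + 1 / real (Suc n) \<le> infdist x C"
      unfolding infdist_notempty[OF assms(3)] using assms(3) by (intro cINF_greatest) (auto simp: not_less)
    then show False by (simp add: d_def)
  qed
  then obtain y where yC: "\<And>n. y n \<in> C" and y: "\<And>n. dist x (y n) < d + 1 / real (Suc n)"
    by metis
  \<comment> \<open>The midpoint of \<open>a\<close> and \<open>b\<close> lies in \<open>C\<close>,
    so its distance from \<open>x\<close> is at least \<open>d\<close>; two almost nearest points
    are therefore close to each other.\<close>
  have parallelogram: "(dist a b)\<^sup>2 \<le> 4 * (s\<^sup>2 - d\<^sup>2)"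
    if "a \<in> C" "b \<in> C" "dist x a \<le> s" "dist x b \<le> s" for a b s
  proof -
    have mid: "(1/2) *\<^sub>R a + (1/2) *\<^sub>R b \<in> C"
      using assms(2) that by (auto intro!: convexD)
    have "d\<^sup>2 \<le> (dist x ((1/2) *\<^sub>R a + (1/2) *\<^sub>R b))\<^sup>2"
      using d_le[OF mid] d0 by (intro power_mono)
    moreover have "(dist x a)\<^sup>2 \<le> s\<^sup>2" "(dist x b)\<^sup>2 \<le> s\<^sup>2"
      using that by (auto intro!: power_mono)
    moreover have "(dist a b)\<^sup>2 = 2 * (dist x a)\<^sup>2 + 2 * (dist x b)\<^sup>2
        - 4 * (dist x ((1/2) *\<^sub>R a + (1/2) *\<^sub>R b))\<^sup>2"
      by (simp add: dist_norm power2_norm_eq_inner algebra_simps inner_commute)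
    ultimately show ?thesis unfolding right_diff_distrib by linarith
  qed
  have "Cauchy y"
  proof (rule metric_CauchyI)
    fix \<epsilon> :: real assume "\<epsilon> > 0"
    then obtain N where N: "1 / real (Suc N) < \<epsilon>\<^sup>2 / (4 * (2 * d + 1))"
      using d0 nat_approx_posE[of "\<epsilon>\<^sup>2 / (4 * (2 * d + 1))"] by (auto simp: zero_less_divide_iff)
    define h where "h = 1 / real (Suc N)"
    have h: "0 < h" "h \<le> 1" by (auto simp: h_def)
    have "dist (y m) (y n) < \<epsilon>" if "m \<ge> N" "n \<ge> N" for m n
    proof -
      have "dist x (y k) \<le> d + h" if "k \<ge> N" for k
      proof -
        have "1 / real (Suc k) \<le> h" using that by (simp add: h_def frac_le)
        then show ?thesis using y[of k] by linarith
      qed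
      then have "(dist (y m) (y n))\<^sup>2 \<le> 4 * ((d + h)\<^sup>2 - d\<^sup>2)"
        using that by (intro parallelogram yC) auto
      also have "\<dots> = 4 * (2 * d + h) * h" by (simp add: power2_eq_square algebra_simps)
      also have "\<dots> \<le> 4 * (2 * d + 1) * h" using h d0 by (intro mult_right_mono) auto
      also have "\<dots> < \<epsilon>\<^sup>2"
        using N d0 unfolding h_def[symmetric] by (simp add: pos_less_divide_eq mult.commute)
      finally show ?thesis using \<open>\<epsilon> > 0\<close> by (simp add: power2_less_imp_less)
    qed
    then show "\<exists>M. \<forall>m\<ge>M. \<forall>n\<ge>M. dist (y m) (y n) < \<epsilon>" by blast
  qed
  then obtain p where p: "y \<longlonglongrightarrow> p" using Cauchy_convergent convergent_def by blast
  have "p \<in> C" using closed_sequentially[OF assms(1)] yC p by blast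
  moreover have "dist x p \<le> d"
  proof (rule LIMSEQ_le)
    show "(\<lambda>n. dist x (y n)) \<longlonglongrightarrow> dist x p" by (intro tendsto_intros p)
    show "(\<lambda>n. d + 1 / real (Suc n)) \<longlonglongrightarrow> d"
      using tendsto_add[OF tendsto_const[of d] LIMSEQ_Suc[OF lim_1_over_n]] by simp
    show "\<exists>N. \<forall>n\<ge>N. dist x (y n) \<le> d + 1 / real (Suc n)" using y less_imp_le by blast
  qed
  ultimately show ?thesis using d_le by (meson order_trans)
qed

text \<open>The obtuse angle condition yields a Pythagorean inequality, which makes \<open>p\<close>
  the nearest point and the only one. All explicit projections below are found through this
  criterion.\<close>

lemma proj_on_eqI:
  fixes C :: "'a::real_inner set"
  assumes "p \<in> C" and obtuse: "\<And>y. y \<in> C \<Longrightarrow> (x - p) \<bullet> (y - p) \<le> 0"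
  shows "proj_on C x = p"
proof -
  have pyth: "(dist x p)\<^sup>2 + (dist p y)\<^sup>2 \<le> (dist x y)\<^sup>2" if "y \<in> C" for y
    using obtuse[OF that]
    by (simp add: dist_norm power2_norm_eq_inner algebra_simps inner_commute)
  show ?thesis unfolding proj_on_def
  proof (rule the_equality)
    have "dist x p \<le> dist x y" if "y \<in> C" for y
    proof (rule power2_le_imp_le)
      show "(dist x p)\<^sup>2 \<le> (dist x y)\<^sup>2"
        using pyth[OF that] zero_le_power2[of "dist p y"] by linarith
    qed simp
    then show "p \<in> C \<and> (\<forall>y\<in>C. dist x p \<le> dist x y)" using assms(1) by blast
  next
    fix z assume z: "z \<in> C \<and> (\<forall>y\<in>C. dist x z \<le> dist x y)"
    then have "(dist x z)\<^sup>2 \<le> (dist x p)\<^sup>2" using assms(1) by (intro power_mono) auto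
    then have "(dist p z)\<^sup>2 \<le> 0" using pyth[of z] z by linarith
    then show "z = p" by simp
  qed
qed

lemma
  fixes C :: "'a::{real_inner, complete_space} set"
  assumes "closed C" "convex C" "C \<noteq> {}"
  shows proj_on_in: "proj_on C x \<in> C"
    and proj_on_obtuse: "y \<in> C \<Longrightarrow> (x - proj_on C x) \<bullet> (y - proj_on C x) \<le> 0"
proof -
  obtain p where p: "p \<in> C" "\<forall>y\<in>C. dist x p \<le> dist x y"
    using nearest_point_exists[OF assms] by blast
  have ob: "(x - p) \<bullet> (y - p) \<le> 0" if "y \<in> C" for y
    by (rule any_closest_point_dot[OF assms(2,1) p(1) that p(2)])
  then have "proj_on C x = p" using p(1) by (intro proj_on_eqI)
  then show "proj_on C x \<in> C" "y \<in> C \<Longrightarrow> (x - proj_on C x) \<bullet> (y - proj_on C x) \<le> 0"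
    using p ob by auto
qed

text \<open>Adding the two obtuse angle conditions gives firm nonexpansiveness, and Cauchy-Schwarz
  finishes.\<close>

lemma dist_proj_on_le:
  fixes C :: "'a::{real_inner, complete_space} set"
  assumes C: "closed C" "convex C" "C \<noteq> {}"
  shows "dist (proj_on C x) (proj_on C y) \<le> dist x y"
proof -
  let ?p = "proj_on C x" and ?q = "proj_on C y"
  have "(x - ?p) \<bullet> (?q - ?p) \<le> 0" "(y - ?q) \<bullet> (?p - ?q) \<le> 0"
    by (intro proj_on_obtuse[OF C] proj_on_in[OF C])+
  then have "(?p - ?q) \<bullet> (?p - ?q) \<le> (x - y) \<bullet> (?p - ?q)"
    by (simp add: algebra_simps)
  also have "\<dots> \<le> norm (x - y) * norm (?p - ?q)" by (rule norm_cauchy_schwarz)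
  finally have "norm (?p - ?q) * norm (?p - ?q) \<le> norm (x - y) * norm (?p - ?q)"
    by (simp add: dot_square_norm power2_eq_square)
  then show ?thesis by (cases "?p = ?q") (auto simp: dist_norm)
qed

lemma proj_on_orthogonal_comp_singleton:
  fixes a :: "'a::real_inner"
  assumes "a \<bullet> a = 1"
  shows "proj_on ({a}\<^sup>\<bottom>) x = x - (a \<bullet> x) *\<^sub>R a"
  using assms
  by (intro proj_on_eqI) (auto simp: orthogonal_comp_def orthogonal_def inner_diff_right)

text \<open>Applied with \<open>W = V\<close>, this keeps the sequence \<open>u\<close> at
  0.\<close>

lemma proj_on_orthogonal_comp_eq_0:
  fixes x :: "'a::real_inner"
  assumes "x \<in> W"
  shows "proj_on (W\<^sup>\<bottom>) x = 0"
  using assms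
  by (intro proj_on_eqI) (auto simp: orthogonal_comp_def orthogonal_def)

text \<open>Since \<open>B\<close> is the inverse of \<open>T\<close> minus the identity,
  \<open>Id + B\<close> is the inverse of \<open>T\<close> and its resolvent is \<open>T\<close>;
  the resolvent of the inverse of \<open>B\<close> is the complementary part \<open>z - T z\<close>.
  Both are shown to be singletons, so \<open>the_elem\<close> gives a genuine value.\<close>

lemma
  fixes T :: "'a::ab_group_add \<Rightarrow> 'a"
  defines "B \<equiv> setop_diff (setop_inverse (setop_of_map T)) (setop_of_map id)"
  shows resolvent_map_inverse_minus_id: "resolvent_map B z = T z"
    and resolvent_map_inverse_of_inverse_minus_id: "resolvent_map (setop_inverse B) z = z - T z"
    and in_inverse_minus_id_iff: "v \<in> B w \<longleftrightarrow> T (w + v) = w"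
proof -
  show B: "v \<in> B w \<longleftrightarrow> T (w + v) = w" for v w
    by (auto simp: B_def setop_diff_def setop_inverse_def setop_of_map_def
      intro: exI[of _ "w + v"])
  have "y \<in> resolvent B z \<longleftrightarrow> (\<exists>v. v \<in> B y \<and> z = y + v)" for y
    by (auto simp: resolvent_def setop_inverse_def setop_add_def setop_of_map_def)
  then have "y \<in> resolvent B z \<longleftrightarrow> T z = y" for y
    unfolding B by (auto intro: exI[of _ "z - y"])
  then have "resolvent B z = {T z}" by (auto simp: set_eq_iff)
  then show "resolvent_map B z = T z" by (simp add: resolvent_map_def)
  have "y \<in> resolvent (setop_inverse B) z \<longleftrightarrow> (\<exists>v. y \<in> B v \<and> z = y + v)" for y
    by (auto simp: resolvent_def setop_inverse_def setop_add_def setop_of_map_def)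
  then have "y \<in> resolvent (setop_inverse B) z \<longleftrightarrow> y = z - T z" for y
    unfolding B by (auto simp: add.commute intro: exI[of _ "T z"])
  then have "resolvent (setop_inverse B) z = {z - T z}" by (auto simp: set_eq_iff)
  then show "resolvent_map (setop_inverse B) z = z - T z" by (simp add: resolvent_map_def)
qed

section \<open>The cone spanned by the curve and its polar\<close>

lemma hull_closed_convex_cone:
  "closed ((\<lambda>C. closed C \<and> convex_cone C) hull S) \<and> convex_cone ((\<lambda>C. closed C \<and> convex_cone C) hull S)"
  using hull_in[of "\<lambda>C. closed C \<and> convex_cone C" S] by (simp add: closed_Inter convex_cone_Inter)

lemma curve_cone_closed: "closed (curve_cone e)"
  and curve_cone_convex_cone: "convex_cone (curve_cone e)"
  using hull_closed_convex_cone unfolding curve_cone_def by auto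

lemma curve_point_in_curve_cone: "0 \<le> \<xi> \<Longrightarrow> curve_point e \<xi> \<in> curve_cone e"
  unfolding curve_cone_def by (rule hull_inc) blast

text \<open>A closed half-space bounded by a hyperplane through 0 is a closed convex cone, so a
  polar inequality has to be checked on the generators only.\<close>

lemma inner_curve_cone_le_0:
  fixes w :: "'a::real_inner"
  assumes "\<And>\<xi>. 0 \<le> \<xi> \<Longrightarrow> w \<bullet> curve_point e \<xi> \<le> 0" "y \<in> curve_cone e"
  shows "w \<bullet> y \<le> 0"
proof -
  have "curve_cone e \<subseteq> {y. w \<bullet> y \<le> 0}"
    unfolding curve_cone_def
    by (rule hull_minimal) (auto simp: assms(1) closed_halfspace_le convex_cone_halfspace_le)
  then show ?thesis using assms(2) by blast
qed

section \<open>One step along the curve\<close>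

lemma x_cos_le_sin:
  fixes x :: real
  assumes "0 \<le> x" "x \<le> pi"
  shows "x * cos x \<le> sin x"
proof -
  have "sin 0 - 0 * cos 0 \<le> sin x - x * cos x"
  proof (rule DERIV_nonneg_imp_nondecreasing[OF assms(1)])
    fix t assume "0 \<le> t" "t \<le> x"
    then show "\<exists>y. ((\<lambda>x. sin x - x * cos x) has_real_derivative y) (at t) \<and> 0 \<le> y"
      using assms by (intro exI[of _ "t * sin t"]) (auto intro!: derivative_eq_intros mult_nonneg_nonneg sin_ge_zero simp: algebra_simps)
  qed
  then show ?thesis by simp
qed

text \<open>Take \<open>x_cos_le_sin\<close> at \<open>x / 2\<close>, multiply by
  \<open>2 * cos (x / 2)\<close>, and use that twice the square of \<open>cos (x / 2)\<close> is
  \<open>1 + cos x\<close>, hence at least 1.\<close>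

lemma half_le_sin:
  fixes x :: real
  assumes "0 \<le> x" "x \<le> pi / 2"
  shows "x / 2 \<le> sin x"
proof -
  have c: "0 \<le> cos x" "0 \<le> cos (x/2)" using assms pi_gt_zero by (auto intro!: cos_ge_zero)
  have "x / 2 * cos (x / 2) \<le> sin (x / 2)" using assms by (intro x_cos_le_sin) auto
  then have "x * (cos (x / 2) * cos (x / 2)) \<le> 2 * sin (x / 2) * cos (x / 2)"
    using c by (auto dest: mult_right_mono[of _ _ "cos (x/2)"] simp: algebra_simps)
  moreover have "sin x = 2 * sin (x / 2) * cos (x / 2)" using sin_double[of "x/2"] by simp
  moreover have "cos x = 2 * (cos (x / 2) * cos (x / 2)) - 1"
    using cos_double_cos[of "x/2"] by (simp add: power2_eq_square)
  then have "x * (1 / 2) \<le> x * (cos (x / 2) * cos (x / 2))"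
    using c assms by (intro mult_left_mono) auto
  ultimately show ?thesis by simp
qed

text \<open>The quadratic term in the exponent is what later absorbs the higher-order terms of a
  cubic.\<close>

lemma one_minus_le_exp_quadratic:
  fixes z :: real
  assumes "0 \<le> z" "z < 1"
  shows "1 - z \<le> exp (- z - z\<^sup>2 / 2)"
proof -
  have "ln (1 - z) + z + z\<^sup>2 / 2 \<le> ln (1 - 0) + 0 + 0\<^sup>2 / 2"
  proof (rule DERIV_nonpos_imp_nonincreasing[OF assms(1)])
    fix t assume t: "0 \<le> t" "t \<le> z"
    have "((\<lambda>z. ln (1 - z) + z + z\<^sup>2 / 2) has_real_derivative - (t\<^sup>2 / (1 - t))) (at t)"
      using t assms by (auto intro!: derivative_eq_intros simp: field_simps power2_eq_square)
    then show "\<exists>y. ((\<lambda>z. ln (1 - z) + z + z\<^sup>2 / 2) has_real_derivative y) (at t) \<and> y \<le> 0"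
      using t assms by (intro exI conjI) auto
  qed
  then have "ln (1 - z) \<le> - z - z\<^sup>2 / 2" by simp
  then have "exp (ln (1 - z)) \<le> exp (- z - z\<^sup>2 / 2)" by simp
  then show ?thesis using assms by simp
qed

text \<open>At \<open>\<eta> = \<xi>\<close> both sides and their derivatives agree. The left side is concave where it is
  positive, whereas the right side is convex on \<open>[1, \<infinity>)\<close>.\<close>

lemma cos_minus_sin_le_exp_cubic:
  fixes \<xi> \<eta> :: real
  assumes "1 \<le> \<xi>" "1 \<le> \<eta>" "\<bar>\<eta> - \<xi>\<bar> \<le> 1"
  shows "cos (pi * (\<eta> - \<xi>) / 2) - 600 / pi * \<xi>\<^sup>2 * sin (pi * (\<eta> - \<xi>) / 2)
    \<le> exp (- 100 * (\<eta> ^ 3 - \<xi> ^ 3))"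
proof (cases "\<xi> \<le> \<eta>")
  case True
  define d where "d = \<eta> - \<xi>"
  have d: "0 \<le> d" "d \<le> 1" using True assms by (auto simp: d_def)
  define \<psi> where "\<psi> = pi * d / 2"
  \<comment> \<open>\<open>z\<close> is the part of \<open>100 * (\<eta> ^ 3 - \<xi> ^ 3)\<close>
    that is linear in \<open>d\<close>.\<close>
  define z where "z = 300 * \<xi>\<^sup>2 * d"
  have \<psi>: "0 \<le> \<psi>" "\<psi> \<le> pi / 2" using d by (auto simp: \<psi>_def)
  have z\<psi>: "600 / pi * \<xi>\<^sup>2 * \<psi> = z" by (simp add: z_def \<psi>_def)
  have z0: "0 \<le> z" using d by (simp add: z_def)
  have c0: "0 \<le> cos \<psi>" using \<psi> by (intro cos_ge_zero) auto
  \<comment> \<open>Replacing \<open>sin \<psi>\<close> by the smaller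
    \<open>\<psi> * cos \<psi>\<close> lets \<open>cos \<psi>\<close> factor out of the left
    side.\<close>
  have "600 / pi * \<xi>\<^sup>2 * (\<psi> * cos \<psi>) \<le> 600 / pi * \<xi>\<^sup>2 * sin \<psi>"
    using \<psi> by (intro mult_left_mono x_cos_le_sin) auto
  then have "cos \<psi> - 600 / pi * \<xi>\<^sup>2 * sin \<psi> \<le> cos \<psi> - 600 / pi * \<xi>\<^sup>2 * \<psi> * cos \<psi>"
    by (simp add: mult.assoc)
  also have "\<dots> = cos \<psi> * (1 - z)" unfolding z\<psi> by (simp add: algebra_simps)
  also have "\<dots> \<le> exp (- 100 * (\<eta> ^ 3 - \<xi> ^ 3))"
  proof (cases "z < 1")
    case True
    have "cos \<psi> * (1 - z) \<le> 1 * (1 - z)" using True by (intro mult_right_mono) auto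
    also have "\<dots> \<le> exp (- z - z\<^sup>2 / 2)" using one_minus_le_exp_quadratic[OF z0 True] by simp
    also have "\<dots> \<le> exp (- 100 * (\<eta> ^ 3 - \<xi> ^ 3))"
    proof -
      have eq: "100 * (\<eta> ^ 3 - \<xi> ^ 3) = z + 300 * \<xi> * d\<^sup>2 + 100 * d ^ 3"
        by (simp add: z_def d_def power2_eq_square power3_eq_cube algebra_simps)
      \<comment> \<open>As \<open>1 \<le> \<xi>\<close> and \<open>d \<le> 1\<close>, half the
        square of \<open>z\<close> dominates the quadratic and cubic terms of the exponent.\<close>
      have "\<xi> \<le> \<xi> ^ 4" "1 \<le> \<xi> ^ 4" using assms self_le_power[of \<xi> 4] one_le_power[of \<xi> 4] by auto
      then have "300 * \<xi> + 100 * d \<le> 45000 * \<xi> ^ 4" using d by linarith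
      then have "(300 * \<xi> + 100 * d) * d\<^sup>2 \<le> 45000 * \<xi> ^ 4 * d\<^sup>2" by (intro mult_right_mono) auto
      also have "\<dots> = z\<^sup>2 / 2" by (simp add: z_def power_mult_distrib)
      finally show ?thesis using eq by (simp add: algebra_simps power2_eq_square power3_eq_cube)
    qed
    finally show ?thesis .
  next
    case False
    then have "cos \<psi> * (1 - z) \<le> 0" using c0 by (intro mult_nonneg_nonpos) auto
    then show ?thesis by (meson exp_ge_zero order_trans)
  qed
  finally show ?thesis by (simp add: \<psi>_def d_def)
next
  case False
  define d where "d = \<xi> - \<eta>"
  have d: "0 \<le> d" "d \<le> 1" using False assms by (auto simp: d_def)
  \<comment> \<open>The left side is at most \<open>1 + 300 \<xi>^2 d\<close>, which exceeds
    \<open>1 + y\<close> by at most \<open>300 \<xi> d^2\<close>. The lower bound on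
    \<open>y\<close> makes this excess at most \<open>y^2 / 2\<close>, so the quadratic Taylor bound
    of \<open>exp y\<close> suffices.\<close>
  define y where "y = 100 * (\<xi> ^ 3 - \<eta> ^ 3)"
  have sin_le: "sin (pi * d / 2) \<le> pi * d / 2" using d by (intro sin_x_le_x) auto
  have y: "y = 300 * \<xi>\<^sup>2 * d - 300 * \<xi> * d\<^sup>2 + 100 * d ^ 3"
    by (simp add: y_def d_def power2_eq_square power3_eq_cube algebra_simps)
  have "300 * \<xi> * d * 1 \<le> 300 * \<xi> * d * \<eta>" using assms d by (intro mult_left_mono) auto
  also have "\<dots> = 300 * \<xi>\<^sup>2 * d - 300 * \<xi> * d\<^sup>2" by (simp add: d_def power2_eq_square algebra_simps)
  also have "\<dots> \<le> y" unfolding y using d by simp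
  finally have ylow: "300 * \<xi> * d \<le> y" by simp
  have "(300 * \<xi> * d)\<^sup>2 \<le> y\<^sup>2" using ylow assms d by (intro power_mono) auto
  moreover have "300 * \<xi> * d\<^sup>2 \<le> (300 * \<xi> * d)\<^sup>2 / 2"
  proof -
    have "300 * \<xi> \<le> 45000 * \<xi>\<^sup>2" using assms self_le_power[of \<xi> 2] by auto
    then have "300 * \<xi> * d\<^sup>2 \<le> 45000 * \<xi>\<^sup>2 * d\<^sup>2" by (intro mult_right_mono) auto
    then show ?thesis by (simp add: power_mult_distrib)
  qed
  ultimately have "300 * \<xi>\<^sup>2 * d \<le> y + y\<^sup>2 / 2" using y zero_le_power[OF d(1), of 3] by linarith
  moreover have "1 + y + y\<^sup>2 / 2 \<le> exp y"
    using ylow assms d by (intro exp_lower_Taylor_quadratic) (smt (verit) mult_nonneg_nonneg)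
  moreover have "600 / pi * \<xi>\<^sup>2 * sin (pi * d / 2) \<le> 600 / pi * \<xi>\<^sup>2 * (pi * d / 2)"
    using sin_le by (intro mult_left_mono) auto
  then have "600 / pi * \<xi>\<^sup>2 * sin (pi * d / 2) \<le> 300 * \<xi>\<^sup>2 * d"
    by (simp add: mult_ac)
  moreover have "cos (pi * d / 2) \<le> 1" by simp
  ultimately have "cos (pi * d / 2) + 600 / pi * \<xi>\<^sup>2 * sin (pi * d / 2) \<le> exp y" by linarith
  moreover have "pi * (\<eta> - \<xi>) / 2 = - (pi * d / 2)" by (simp add: d_def field_simps)
  moreover have "- 100 * (\<eta> ^ 3 - \<xi> ^ 3) = y" by (simp add: y_def algebra_simps)
  ultimately show ?thesis by (simp only: cos_minus sin_minus)
qed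

lemma one_minus_cos_le:
  fixes x :: real
  shows "1 - cos x \<le> x\<^sup>2 / 2"
proof -
  have "(sin (x / 2))\<^sup>2 \<le> (x / 2)\<^sup>2"
    using abs_sin_x_le_abs_x[of "x/2"] unfolding abs_le_square_iff .
  then show ?thesis using cos_double_sin[of "x / 2"] by (simp add: power_divide)
qed

text \<open>The Taylor bound gives
  \<open>exp (100 \<xi>^3) \<ge> 5000 \<xi>^6 \<ge> 5000 \<xi>^2\<close>; inverting and squaring
  gives the constant. In \<open>curve_step\<close> this makes the pull of the \<open>e 0\<close>
  coefficient small against \<open>1 / m^2\<close>.\<close>

lemma exp_cubic_le:
  fixes \<xi> :: real
  assumes "1 \<le> \<xi>"
  shows "\<xi> ^ 4 * (exp (- 100 * \<xi> ^ 3))\<^sup>2 \<le> 1 / 25000000"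
proof -
  define \<epsilon> where "\<epsilon> = exp (- 100 * \<xi> ^ 3)"
  have \<epsilon>: "0 \<le> \<epsilon>" by (simp add: \<epsilon>_def)
  have inv: "\<epsilon> * exp (100 * \<xi> ^ 3) = 1" by (simp add: \<epsilon>_def flip: exp_add)
  have "1 + 100 * \<xi> ^ 3 + (100 * \<xi> ^ 3)\<^sup>2 / 2 \<le> exp (100 * \<xi> ^ 3)"
    using assms by (intro exp_lower_Taylor_quadratic) auto
  moreover have "(100 * \<xi> ^ 3)\<^sup>2 / 2 = 5000 * \<xi> ^ 6" by (simp add: power_mult_distrib)
  moreover have "0 \<le> \<xi> ^ 3" "\<xi>\<^sup>2 \<le> \<xi> ^ 6" using assms by (auto intro: power_increasing)
  ultimately have "5000 * \<xi>\<^sup>2 \<le> exp (100 * \<xi> ^ 3)" by linarith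
  then have "\<epsilon> * (5000 * \<xi>\<^sup>2) \<le> 1" using mult_left_mono[OF _ \<epsilon>] inv by metis
  then have "(\<epsilon> * (5000 * \<xi>\<^sup>2))\<^sup>2 \<le> 1" using \<epsilon> by (intro power_le_one) auto
  then show ?thesis unfolding \<epsilon>_def[symmetric] by (simp add: power_mult_distrib mult.commute)
qed

text \<open>These are the optimality conditions for \<open>t *\<^sub>R curve_point e \<xi>\<close>
  to be the projection of the arc point at \<open>r\<close> onto the cone. The cosine equation makes
  the residual orthogonal to the ray, the sine inequality serves the following arc, and the last
  conclusion is the polar inequality along the arc itself. The first bound is a guaranteed gain, so
  that finitely many steps cross the arc; the bound on \<open>1 - t\<close> is the loss of
  norm.\<close>

lemma curve_step:
  fixes r :: real and m :: nat
  assumes m: "1 \<le> m" and r: "real m \<le> r" "r \<le> real m + 1 - 1 / (50 * (real m)\<^sup>2)"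
  obtains \<xi> t where "r + exp (- 200 * (real m + 1) ^ 3) \<le> \<xi>" "\<xi> < real m + 1"
    "0 \<le> t" "t \<le> 1" "1 - t \<le> (\<xi> - r) / (30 * (real m)\<^sup>2)"
    "cos (pi * (\<xi> - r) / 2) = t * (1 + (exp (- 100 * \<xi> ^ 3))\<^sup>2)"
    "sin (pi * (r - real m) / 2) \<le> t * sin (pi * (\<xi> - real m) / 2)"
    "\<And>\<eta>. \<lbrakk>real m \<le> \<eta>; \<eta> \<le> real m + 1\<rbrakk> \<Longrightarrow>
      cos (pi * (\<eta> - r) / 2) - t * cos (pi * (\<eta> - \<xi>) / 2)
        \<le> t * exp (- 100 * \<xi> ^ 3) * exp (- 100 * \<eta> ^ 3)"
proof -
  \<comment> \<open>Half of the margin left before the end of the arc: \<open>\<xi>\<close> is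
    sought within \<open>\<delta>\<close> of \<open>r\<close>, so that at least
    \<open>\<delta>\<close> remains beyond it.\<close>
  define \<delta> where "\<delta> = 1 / (100 * (real m)\<^sup>2)"
  define \<epsilon> :: "real \<Rightarrow> real" where "\<epsilon> = (\<lambda>\<xi>. exp (- 100 * \<xi> ^ 3))"
  \<comment> \<open>The logarithmic decay rate \<open>300 \<xi>^2\<close> of
    \<open>\<epsilon>\<close> divided by the angular speed \<open>pi / 2\<close>.\<close>
  define \<kappa> :: "real \<Rightarrow> real" where "\<kappa> = (\<lambda>\<xi>. 600 / pi * \<xi>\<^sup>2)"
  have m1: "1 \<le> real m" using m by simp
  have msq: "1 \<le> (real m)\<^sup>2" using m1 by (simp add: one_le_power)
  have "2 * \<delta> = 1 / (50 * (real m)\<^sup>2)" "\<delta> \<le> 1 / (100 * 1)"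
    unfolding \<delta>_def using msq by (simp, intro frac_le) auto
  then have \<delta>: "0 < \<delta>" "\<delta> \<le> 1 / 100" "r + 2 * \<delta> \<le> real m + 1"
    using m1 r by (auto simp: \<delta>_def)
  have \<epsilon>: "0 < \<epsilon> \<xi>" for \<xi> by (simp add: \<epsilon>_def)
  have pi: "2 < pi" "pi < 4" using pi_gt3 pi_less_4 by auto
  have \<kappa>_ge: "150 * (real m)\<^sup>2 \<le> \<kappa> \<xi>" if "real m \<le> \<xi>" for \<xi>
  proof -
    have "150 \<le> 600 / pi" using pi by (simp add: pos_le_divide_eq)
    moreover have "(real m)\<^sup>2 \<le> \<xi>\<^sup>2" using that m1 by (intro power_mono) auto
    ultimately show ?thesis unfolding \<kappa>_def by (intro mult_mono) auto
  qed
  \<comment> \<open>Both sides of the last conclusion agree at \<open>\<eta> = \<xi>\<close>, so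
    their derivatives must agree there as well: \<open>sin \<theta> = \<kappa> \<xi> * t *
    (\<epsilon> \<xi>)\<^sup>2\<close>, where \<open>\<theta>\<close> is the angle from
    \<open>r\<close> to \<open>\<xi>\<close>. Eliminating \<open>t\<close> by the cosine equation
    gives \<open>h \<xi> = 0\<close>.\<close>
  define h where "h = (\<lambda>\<xi>. sin (pi * (\<xi> - r) / 2) * (1 + (\<epsilon> \<xi>)\<^sup>2) - \<kappa> \<xi> * (\<epsilon> \<xi>)\<^sup>2 * cos (pi * (\<xi> - r) / 2))"
  have "\<exists>\<xi>\<ge>r. \<xi> \<le> r + \<delta> \<and> h \<xi> = 0"
  proof (rule IVT')
    show "h r \<le> 0" by (simp add: h_def \<kappa>_def)
    show "continuous_on {r..r + \<delta>} h"
      unfolding h_def \<epsilon>_def \<kappa>_def by (intro continuous_intros) auto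
    \<comment> \<open>At this point the sine is at least \<open>\<delta> / 2\<close>, whereas
      \<open>\<kappa>\<close> times the square of \<open>\<epsilon>\<close> is at most
      \<open>\<delta> / 2\<close>.\<close>
    show "0 \<le> h (r + \<delta>)"
    proof -
      let ?\<xi> = "r + \<delta>"
      have \<xi>: "1 \<le> ?\<xi>" "real m \<le> ?\<xi>" using r m1 \<delta> by auto
      have "\<delta> / 2 \<le> pi * \<delta> / 2 / 2" using pi \<delta> by simp
      also have "\<dots> \<le> sin (pi * \<delta> / 2)" using pi \<delta> by (intro half_le_sin) auto
      finally have s: "\<delta> / 2 \<le> sin (pi * \<delta> / 2)" .
      have "(real m)\<^sup>2 * (\<kappa> ?\<xi> * (\<epsilon> ?\<xi>)\<^sup>2) \<le> ?\<xi>\<^sup>2 * (300 * ?\<xi>\<^sup>2 * (\<epsilon> ?\<xi>)\<^sup>2)"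
      proof -
        have "600 / pi \<le> 300" using pi by (simp add: pos_divide_le_eq)
        then have "\<kappa> ?\<xi> \<le> 300 * ?\<xi>\<^sup>2" unfolding \<kappa>_def by (intro mult_right_mono) auto
        moreover have "(real m)\<^sup>2 \<le> ?\<xi>\<^sup>2" using \<xi> by (intro power_mono) auto
        ultimately show ?thesis
          using \<kappa>_ge[OF \<xi>(2)] by (intro mult_mono) (auto simp: \<kappa>_def)
      qed
      also have "\<dots> = 300 * (?\<xi> ^ 4 * (\<epsilon> ?\<xi>)\<^sup>2)" by (simp add: power2_eq_square power4_eq_xxxx)
      also have "\<dots> \<le> 300 * (1 / 25000000)"
        unfolding \<epsilon>_def using \<xi> by (intro mult_left_mono exp_cubic_le) auto
      also have "\<dots> \<le> 1 / 200" by simp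
      also have "\<dots> = (real m)\<^sup>2 * (\<delta> / 2)" using m1 by (simp add: \<delta>_def)
      finally have \<kappa>\<epsilon>: "\<kappa> ?\<xi> * (\<epsilon> ?\<xi>)\<^sup>2 \<le> \<delta> / 2"
        by (rule mult_left_le_imp_le) (use msq in linarith)
      have "\<kappa> ?\<xi> * (\<epsilon> ?\<xi>)\<^sup>2 * cos (pi * \<delta> / 2) \<le> \<kappa> ?\<xi> * (\<epsilon> ?\<xi>)\<^sup>2 * 1"
        by (intro mult_left_mono) (auto simp: \<kappa>_def)
      also have "\<dots> \<le> sin (pi * \<delta> / 2) * 1" using \<kappa>\<epsilon> s by linarith
      also have "\<dots> \<le> sin (pi * \<delta> / 2) * (1 + (\<epsilon> ?\<xi>)\<^sup>2)"
        using s \<delta> by (intro mult_left_mono) auto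
      finally show ?thesis by (simp add: h_def)
    qed
  qed (use \<delta> in auto)
  then obtain \<xi> where \<xi>: "r \<le> \<xi>" "\<xi> \<le> r + \<delta>" and h0: "h \<xi> = 0" by blast
  define \<theta> where "\<theta> = pi * (\<xi> - r) / 2"
  define t where "t = cos \<theta> / (1 + (\<epsilon> \<xi>)\<^sup>2)"
  have m\<xi>: "real m \<le> \<xi>" "1 \<le> \<xi>" using r \<xi> m1 by auto
  have \<xi>m: "\<xi> + \<delta> \<le> real m + 1" using \<xi> \<delta> by linarith
  have "pi * (\<xi> - r) \<le> 4 * (\<xi> - r)" using \<xi> pi by (intro mult_right_mono) auto
  then have \<theta>: "0 \<le> \<theta>" "\<theta> \<le> 2 * (\<xi> - r)" using \<xi> by (auto simp: \<theta>_def)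
  have \<theta>1: "\<theta> \<le> 2 * \<delta>" "\<theta> \<le> 1 / 2" using \<theta> \<xi> \<delta> by auto
  have den: "0 < 1 + (\<epsilon> \<xi>)\<^sup>2" by (simp add: add_pos_nonneg)
  have t\<epsilon>: "cos \<theta> = t * (1 + (\<epsilon> \<xi>)\<^sup>2)" using den by (simp add: t_def)
  have t0: "0 \<le> t" unfolding t_def using \<theta> \<theta>1 pi den by (intro divide_nonneg_pos cos_ge_zero) auto
  have "sin \<theta> * (1 + (\<epsilon> \<xi>)\<^sup>2) = \<kappa> \<xi> * (\<epsilon> \<xi>)\<^sup>2 * cos \<theta>" using h0 by (simp add: h_def \<theta>_def)
  then have sin\<theta>: "sin \<theta> = \<kappa> \<xi> * t * (\<epsilon> \<xi>)\<^sup>2" using den t\<epsilon> by simp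
  have sin_le: "sin \<theta> \<le> \<theta>" using \<theta> by (simp add: sin_x_le_x)
  have \<kappa>0: "0 < \<kappa> \<xi>" using \<kappa>_ge[OF m\<xi>(1)] msq by linarith
  have t1: "t \<le> 1"
    using t\<epsilon> cos_le_one[of \<theta>] t0 by (simp add: distrib_left) (smt (verit) mult_nonneg_nonneg zero_le_power2)
  \<comment> \<open>\<open>1 - t\<close> is bounded by \<open>\<theta>^2 / 2\<close> plus
    \<open>t \<epsilon>^2\<close>. These are at most \<open>\<theta> / (100 m^2)\<close> and
    \<open>\<theta> / (150 m^2)\<close>, together \<open>\<theta> / (60 m^2)\<close>, and
    \<open>\<theta>\<close> is at most \<open>2 * (\<xi> - r)\<close>.\<close>
  have loss: "1 - t \<le> (\<xi> - r) / (30 * (real m)\<^sup>2)"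
  proof -
    have "150 * (real m)\<^sup>2 * (t * (\<epsilon> \<xi>)\<^sup>2) \<le> \<kappa> \<xi> * (t * (\<epsilon> \<xi>)\<^sup>2)"
      using t0 by (intro mult_right_mono \<kappa>_ge m\<xi>) auto
    then have "150 * (real m)\<^sup>2 * (t * (\<epsilon> \<xi>)\<^sup>2) \<le> \<theta>" using sin\<theta> sin_le by (simp add: mult.assoc)
    moreover have "1 - t \<le> \<theta>\<^sup>2 / 2 + t * (\<epsilon> \<xi>)\<^sup>2"
      using t\<epsilon> one_minus_cos_le[of \<theta>] by (simp add: distrib_left)
    then have "(real m)\<^sup>2 * (1 - t) \<le> (real m)\<^sup>2 * (\<theta>\<^sup>2 / 2 + t * (\<epsilon> \<xi>)\<^sup>2)"
      by (intro mult_left_mono) auto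
    moreover have "(real m)\<^sup>2 * \<theta>\<^sup>2 \<le> \<theta> * (1 / 50)"
    proof -
      have "(real m)\<^sup>2 * \<theta>\<^sup>2 = \<theta> * ((real m)\<^sup>2 * \<theta>)" by (simp add: power2_eq_square)
      also have "\<dots> \<le> \<theta> * ((real m)\<^sup>2 * (2 * \<delta>))" using \<theta> \<theta>1 by (intro mult_left_mono) auto
      also have "\<dots> = \<theta> * (1 / 50)" using m1 by (simp add: \<delta>_def)
      finally show ?thesis .
    qed
    ultimately have "(real m)\<^sup>2 * (1 - t) \<le> \<theta> / 60" by (simp add: distrib_left)
    then have "(real m)\<^sup>2 * (1 - t) \<le> (\<xi> - r) / 30" using \<theta> by linarith
    then show ?thesis using m1 by (simp add: field_simps)
  qed
  \<comment> \<open>From \<open>t \<ge> 1 / 2\<close> and \<open>\<kappa> \<xi> \<ge> 4\<close>, the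
    tangency equation gives \<open>2 \<epsilon>^2 \<le> \<theta> \<le> 2 * (\<xi> - r)\<close>; on
    the arc \<open>\<epsilon>\<close> is smallest at \<open>m + 1\<close>.\<close>
  have gain: "r + exp (- 200 * (real m + 1) ^ 3) \<le> \<xi>"
  proof -
    have "(\<xi> - r) / (30 * (real m)\<^sup>2) \<le> (1 / 2) / 1" using \<xi> \<delta> msq by (intro frac_le) auto
    then have "1 / 2 \<le> t" using loss by linarith
    moreover have "4 \<le> \<kappa> \<xi>" using \<kappa>_ge[OF m\<xi>(1)] msq by linarith
    ultimately have "4 * (1 / 2) * (\<epsilon> \<xi>)\<^sup>2 \<le> \<kappa> \<xi> * t * (\<epsilon> \<xi>)\<^sup>2"
      using \<kappa>0 by (intro mult_right_mono mult_mono) auto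
    then have "2 * (\<epsilon> \<xi>)\<^sup>2 \<le> \<theta>" using sin\<theta> sin_le by simp
    then have "2 * (\<epsilon> \<xi>)\<^sup>2 \<le> 2 * (\<xi> - r)" using \<theta>(2) by (rule order_trans)
    then have "(\<epsilon> \<xi>)\<^sup>2 \<le> \<xi> - r" by simp
    moreover have "exp (- 200 * (real m + 1) ^ 3) \<le> (\<epsilon> \<xi>)\<^sup>2"
    proof -
      have "\<xi> ^ 3 \<le> (real m + 1) ^ 3" using m\<xi> \<xi>m \<delta> by (intro power_mono) auto
      then show ?thesis by (simp add: \<epsilon>_def power2_eq_square flip: exp_add)
    qed
    ultimately show ?thesis by linarith
  qed
  \<comment> \<open>Expanding about \<open>\<xi>\<close> instead of \<open>r\<close> brings out the
    factor \<open>t \<epsilon>^2\<close> and leaves the expression estimated in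
    \<open>cos_minus_sin_le_exp_cubic\<close>.\<close>
  have rot: "cos (pi * (\<eta> - r) / 2) - t * cos (pi * (\<eta> - \<xi>) / 2)
      = t * (\<epsilon> \<xi>)\<^sup>2 * (cos (pi * (\<eta> - \<xi>) / 2) - \<kappa> \<xi> * sin (pi * (\<eta> - \<xi>) / 2))" for \<eta>
  proof -
    have "pi * (\<eta> - r) / 2 = pi * (\<eta> - \<xi>) / 2 + \<theta>" by (simp add: \<theta>_def algebra_simps add_divide_distrib diff_divide_distrib)
    then show ?thesis by (simp only: cos_add sin\<theta> t\<epsilon>) (simp add: algebra_simps)
  qed
  show ?thesis
  proof (rule that[OF gain _ t0 t1 loss])
    show "\<xi> < real m + 1" using \<xi>m \<delta> by linarith
    show "cos (pi * (\<xi> - r) / 2) = t * (1 + (exp (- 100 * \<xi> ^ 3))\<^sup>2)"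
      using t\<epsilon> by (simp add: \<theta>_def \<epsilon>_def)
    show "cos (pi * (\<eta> - r) / 2) - t * cos (pi * (\<eta> - \<xi>) / 2)
        \<le> t * exp (- 100 * \<xi> ^ 3) * exp (- 100 * \<eta> ^ 3)"
      if \<eta>: "real m \<le> \<eta>" "\<eta> \<le> real m + 1" for \<eta>
    proof -
      have "cos (pi * (\<eta> - \<xi>) / 2) - \<kappa> \<xi> * sin (pi * (\<eta> - \<xi>) / 2) \<le> exp (- 100 * (\<eta> ^ 3 - \<xi> ^ 3))"
        unfolding \<kappa>_def using \<eta> m\<xi> \<xi>m \<delta> m1 by (intro cos_minus_sin_le_exp_cubic) auto
      then have "t * (\<epsilon> \<xi>)\<^sup>2 * (cos (pi * (\<eta> - \<xi>) / 2) - \<kappa> \<xi> * sin (pi * (\<eta> - \<xi>) / 2))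
          \<le> t * (\<epsilon> \<xi>)\<^sup>2 * exp (- 100 * (\<eta> ^ 3 - \<xi> ^ 3))"
        using t0 by (intro mult_left_mono) auto
      also have "\<dots> = t * \<epsilon> \<xi> * \<epsilon> \<eta>"
        by (simp add: \<epsilon>_def power2_eq_square algebra_simps flip: exp_add)
      finally show ?thesis using rot[of \<eta>] by (simp add: \<epsilon>_def)
    qed
    \<comment> \<open>The same expansion reduces this to
      \<open>sin \<tau> \<le> \<kappa> \<xi> * cos \<tau>\<close>. Since \<open>\<xi>\<close> stays
      \<open>\<delta>\<close> away from the end, \<open>cos \<tau>\<close> is bounded below by a
      multiple of \<open>1 / m^2\<close>, and the right side is at least 1. The margin in the
      hypothesis on \<open>r\<close> serves this purpose.\<close>
    show "sin (pi * (r - real m) / 2) \<le> t * sin (pi * (\<xi> - real m) / 2)"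
    proof -
      define \<tau> where "\<tau> = pi * (\<xi> - real m) / 2"
      define y where "y = real m + 1 - \<xi>"
      have y: "\<delta> \<le> y" "y \<le> 1" using \<xi>m m\<xi> by (auto simp: y_def)
      have y\<tau>: "\<tau> = pi / 2 - pi * y / 2" by (simp add: \<tau>_def y_def algebra_simps add_divide_distrib diff_divide_distrib)
      have "1 \<le> 600 / pi * (real m)\<^sup>2 * (pi * \<delta> / 4)" using m1 by (simp add: \<delta>_def)
      also have "\<dots> \<le> \<kappa> \<xi> * (pi * y / 2 / 2)"
        unfolding \<kappa>_def using y m\<xi> \<delta> by (intro mult_mono power_mono) auto
      also have "\<dots> \<le> \<kappa> \<xi> * sin (pi * y / 2)"
        using y \<delta> \<kappa>0 by (intro mult_left_mono half_le_sin) auto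
      also have "sin (pi * y / 2) = cos \<tau>" unfolding y\<tau> by (simp add: cos_diff)
      finally have "sin \<tau> - \<kappa> \<xi> * cos \<tau> \<le> 0" using sin_le_one[of \<tau>] by linarith
      moreover have "sin (pi * (r - real m) / 2) = sin (\<tau> - \<theta>)"
        by (simp add: \<tau>_def \<theta>_def algebra_simps add_divide_distrib diff_divide_distrib)
      then have "sin (pi * (r - real m) / 2) - t * sin \<tau> = t * (\<epsilon> \<xi>)\<^sup>2 * (sin \<tau> - \<kappa> \<xi> * cos \<tau>)"
        by (simp only: sin_diff sin\<theta> t\<epsilon>) (simp add: algebra_simps)
      ultimately have "sin (pi * (r - real m) / 2) - t * sin \<tau> \<le> 0"
        using t0 by (auto intro: mult_nonneg_nonpos)
      then show ?thesis by (simp add: \<tau>_def)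
    qed
  qed
qed

section \<open>The iteration\<close>

text \<open>The part of the curve orthogonal to \<open>e 0\<close>, with the piece \<open>m\<close>
  as a parameter in place of the floor: the right endpoint \<open>m + 1\<close> then belongs to the
  same arc.\<close>

definition quarter_arc :: "(nat \<Rightarrow> 'a::real_vector) \<Rightarrow> nat \<Rightarrow> real \<Rightarrow> 'a"
  where "quarter_arc e m r = cos (pi * (r - real m) / 2) *\<^sub>R e (m + 1) + sin (pi * (r - real m) / 2) *\<^sub>R e (m + 2)"

lemma curve_point_arc:
  assumes "real m \<le> \<xi>" "\<xi> < real m + 1"
  shows "curve_point e \<xi> = exp (- 100 * \<xi> ^ 3) *\<^sub>R e 0 + quarter_arc e m \<xi>"
proof -
  have "\<lfloor>\<xi>\<rfloor> = int m" using assms by (simp add: floor_eq_iff)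
  then show ?thesis by (simp add: curve_point_def quarter_arc_def)
qed

lemma curve_point_cases:
  assumes "0 \<le> \<xi>"
  obtains j where "real j \<le> \<xi>" "\<xi> < real j + 1"
    "curve_point e \<xi> = exp (- 100 * \<xi> ^ 3) *\<^sub>R e 0 + quarter_arc e j \<xi>"
proof -
  have "real (nat \<lfloor>\<xi>\<rfloor>) \<le> \<xi>" "\<xi> < real (nat \<lfloor>\<xi>\<rfloor>) + 1" using assms by linarith+
  then show thesis using that curve_point_arc by blast
qed

lemma arc_start: "quarter_arc e m (real m) = e (m + 1)"
  and arc_end: "quarter_arc e m (real m + 1) = e (m + 2)"
  by (simp_all add: quarter_arc_def)

text \<open>This is the resolvent of \<open>B\<close>; its powers generate the sequence
  \<open>x\<close>.\<close>

definition partial_inverse_map :: "(nat \<Rightarrow> 'a::real_inner) \<Rightarrow> 'a \<Rightarrow> 'a"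
  where "partial_inverse_map e = proj_on ({e 0}\<^sup>\<bottom>) \<circ> proj_on (curve_cone e) \<circ> proj_on ({e 0}\<^sup>\<bottom>)"

context
  fixes e :: "nat \<Rightarrow> 'a::{real_inner, complete_space}"
  assumes orthonormal: "\<And>i j. e i \<bullet> e j = (if i = j then 1 else 0)"
begin

section \<open>The map and its nonexpansiveness\<close>

lemma proj_on_hyperplane: "proj_on ({e 0}\<^sup>\<bottom>) x = x - (e 0 \<bullet> x) *\<^sub>R e 0"
  by (rule proj_on_orthogonal_comp_singleton) (simp add: orthonormal)

lemmas curve_cone_proj =
  curve_cone_closed[of e] curve_cone_convex_cone[of e, unfolded convex_cone_def, THEN conjunct2, THEN conjunct1]
  curve_cone_convex_cone[of e, THEN convex_cone_nonempty]

lemma partial_inverse_map_alt: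
  "partial_inverse_map e x = (let k = proj_on (curve_cone e) (x - (e 0 \<bullet> x) *\<^sub>R e 0) in k - (e 0 \<bullet> k) *\<^sub>R e 0)"
  by (simp add: partial_inverse_map_def proj_on_hyperplane Let_def)

lemma e0_inner_partial_inverse_map: "e 0 \<bullet> partial_inverse_map e x = 0"
  by (simp add: partial_inverse_map_alt Let_def inner_diff_right orthonormal)

lemma norm_minus_component_le: "norm (x - (e 0 \<bullet> x) *\<^sub>R e 0) \<le> norm x"
proof (rule power2_le_imp_le)
  have "(norm (x - (e 0 \<bullet> x) *\<^sub>R e 0))\<^sup>2 = (norm x)\<^sup>2 - (e 0 \<bullet> x)\<^sup>2"
    unfolding power2_norm_eq_inner
    by (simp add: inner_diff_left inner_diff_right inner_commute[of x "e 0"] orthonormal power2_eq_square)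
  then show "(norm (x - (e 0 \<bullet> x) *\<^sub>R e 0))\<^sup>2 \<le> (norm x)\<^sup>2" by simp
qed simp

lemma dist_partial_inverse_map_le:
  "dist (partial_inverse_map e x) (partial_inverse_map e y) \<le> dist x y"
proof -
  have V: "dist (x - (e 0 \<bullet> x) *\<^sub>R e 0) (y - (e 0 \<bullet> y) *\<^sub>R e 0) \<le> dist x y" for x y
    using norm_minus_component_le[of "x - y"] by (simp add: dist_norm algebra_simps)
  show ?thesis
    unfolding partial_inverse_map_alt Let_def
    by (meson V dist_proj_on_le[OF curve_cone_proj] order_trans)
qed

lemma dist_iterate_le:
  "dist ((partial_inverse_map e ^^ n) x) ((partial_inverse_map e ^^ n) y) \<le> dist x y"
proof (induction n)
  case (Suc n)
  then show ?case using dist_partial_inverse_map_le order_trans by fastforce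
qed simp

lemma partial_inverse_map_0: "partial_inverse_map e 0 = 0"
proof -
  have "0 \<in> curve_cone e" by (rule convex_cone_contains_0[OF curve_cone_convex_cone])
  moreover have "0 \<bullet> y \<le> (0::real)" for y :: 'a by simp
  ultimately have "proj_on (curve_cone e) 0 = 0"
    by (intro proj_on_eqI) auto
  then show ?thesis by (simp add: partial_inverse_map_alt)
qed

section \<open>Geometry of the arcs and the action of the map on them\<close>

lemma inner_arc: "quarter_arc e m r \<bullet> quarter_arc e m s = cos (pi * (r - s) / 2)"
proof -
  have angle: "pi * (r - s) / 2 = pi * (r - real m) / 2 - pi * (s - real m) / 2"
    by (simp add: field_simps)
  then show ?thesis
    unfolding angle cos_diff by (simp add: quarter_arc_def inner_add_left inner_add_right orthonormal)
qed

lemma norm_arc: "norm (quarter_arc e m r) = 1"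
  by (simp add: norm_eq_sqrt_inner inner_arc)

lemma e0_inner_arc: "e 0 \<bullet> quarter_arc e m r = 0"
  by (simp add: quarter_arc_def inner_add_right orthonormal)

lemma dist_arc_le: "dist (quarter_arc e m r) (quarter_arc e m s) \<le> 2 * \<bar>r - s\<bar>"
proof (rule power2_le_imp_le)
  have "(dist (quarter_arc e m r) (quarter_arc e m s))\<^sup>2 = 2 * (1 - cos (pi * (r - s) / 2))"
    using inner_commute[of "quarter_arc e m s" "quarter_arc e m r"]
    by (simp add: dist_norm power2_norm_eq_inner inner_diff_left inner_diff_right inner_arc)
  also have "\<dots> \<le> (pi * (r - s) / 2)\<^sup>2" using one_minus_cos_le[of "pi * (r - s) / 2"] by simp
  also have "\<dots> = (pi / 2)\<^sup>2 * (r - s)\<^sup>2" by (simp add: power_mult_distrib power_divide)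
  also have "\<dots> \<le> 2\<^sup>2 * (r - s)\<^sup>2"
    using pi_less_4 by (intro mult_right_mono power_mono) auto
  also have "\<dots> = (2 * \<bar>r - s\<bar>)\<^sup>2" by (simp add: power_mult_distrib)
  finally show "(dist (quarter_arc e m r) (quarter_arc e m s))\<^sup>2 \<le> (2 * \<bar>r - s\<bar>)\<^sup>2" .
qed simp

text \<open>Before the last \<open>1 / (50 m\<^sup>2)\<close> of the arc, the nearest point of the cone lies on a single
  generating ray, so that the image is a multiple of a point of the arc. Close to the end this
  fails, since rays on both sides of \<open>e (m + 2)\<close> may contribute.\<close>

lemma partial_inverse_map_arc:
  assumes m: "1 \<le> m" and r: "real m \<le> r" "r \<le> real m + 1 - 1 / (50 * (real m)\<^sup>2)"
  obtains \<xi> where "r + exp (- 200 * (real m + 1) ^ 3) \<le> \<xi>" "\<xi> < real m + 1"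
    "dist (partial_inverse_map e (quarter_arc e m r)) (quarter_arc e m \<xi>) \<le> (\<xi> - r) / (30 * (real m)\<^sup>2)"
proof -
  obtain \<xi> t where \<xi>: "r + exp (- 200 * (real m + 1) ^ 3) \<le> \<xi>" "\<xi> < real m + 1"
    and t: "0 \<le> t" "t \<le> 1" "1 - t \<le> (\<xi> - r) / (30 * (real m)\<^sup>2)"
    and stationary: "cos (pi * (\<xi> - r) / 2) = t * (1 + (exp (- 100 * \<xi> ^ 3))\<^sup>2)"
    and sin_le: "sin (pi * (r - real m) / 2) \<le> t * sin (pi * (\<xi> - real m) / 2)"
    and cos_le: "\<And>\<eta>. \<lbrakk>real m \<le> \<eta>; \<eta> \<le> real m + 1\<rbrakk> \<Longrightarrow>
      cos (pi * (\<eta> - r) / 2) - t * cos (pi * (\<eta> - \<xi>) / 2)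
        \<le> t * exp (- 100 * \<xi> ^ 3) * exp (- 100 * \<eta> ^ 3)"
    using curve_step[OF assms] by metis
  have m\<xi>: "real m \<le> \<xi>" using r \<xi>(1) exp_gt_zero[of "- 200 * (real m + 1) ^ 3"] by linarith
  define \<epsilon> where "\<epsilon> = exp (- 100 * \<xi> ^ 3)"
  \<comment> \<open>\<open>w\<close> is the residual without its \<open>e 0\<close> component, which
    is \<open>- t * \<epsilon>\<close>. The polar inequality at \<open>\<eta>\<close> thus says that
    \<open>w\<close> has inner product at most
    \<open>t * \<epsilon> * exp (- 100 * \<eta> ^ 3)\<close> with the arc point.\<close>
  define w where "w = quarter_arc e m r - t *\<^sub>R quarter_arc e m \<xi>"
  have p: "curve_point e \<xi> = \<epsilon> *\<^sub>R e 0 + quarter_arc e m \<xi>"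
    unfolding \<epsilon>_def by (rule curve_point_arc[OF m\<xi> \<xi>(2)])
  have residual: "quarter_arc e m r - t *\<^sub>R curve_point e \<xi> = w - (t * \<epsilon>) *\<^sub>R e 0"
    by (simp add: p w_def algebra_simps)
  have w_arc: "w \<bullet> quarter_arc e m \<eta> \<le> t * \<epsilon> * exp (- 100 * \<eta> ^ 3)" if "real m \<le> \<eta>" "\<eta> \<le> real m + 1" for \<eta>
    using cos_le[OF that] unfolding inner_commute[of w]
    by (simp add: w_def \<epsilon>_def inner_diff_right inner_arc)
  have w_coords: "w = (cos (pi * (r - real m) / 2) - t * cos (pi * (\<xi> - real m) / 2)) *\<^sub>R e (m + 1)
      + (sin (pi * (r - real m) / 2) - t * sin (pi * (\<xi> - real m) / 2)) *\<^sub>R e (m + 2)"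
    by (simp add: w_def quarter_arc_def algebra_simps)
  have le0: "(quarter_arc e m r - t *\<^sub>R curve_point e \<xi>) \<bullet> curve_point e \<eta> \<le> 0" if "0 \<le> \<eta>" for \<eta>
  proof -
    obtain j where j: "real j \<le> \<eta>" "\<eta> < real j + 1"
      and pj: "curve_point e \<eta> = exp (- 100 * \<eta> ^ 3) *\<^sub>R e 0 + quarter_arc e j \<eta>"
      using curve_point_cases[OF \<open>0 \<le> \<eta>\<close>] by metis
    define \<alpha> where "\<alpha> = pi * (\<eta> - real j) / 2"
    define c where "c = cos \<alpha>"
    define s where "s = sin \<alpha>"
    have angle: "0 \<le> \<alpha>" "\<alpha> \<le> pi / 2" "- (pi / 2) \<le> \<alpha>" "\<alpha> \<le> pi"
      using j pi_gt_zero mult_left_mono[of "\<eta> - real j" 1 pi] unfolding \<alpha>_def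
      by (auto simp: intro: order_trans[of _ 0])
    have c: "0 \<le> c" and s: "0 \<le> s" "s \<le> 1"
      unfolding c_def s_def using angle by (auto intro!: cos_ge_zero sin_ge_zero)
    have arc_j: "quarter_arc e j \<eta> = c *\<^sub>R e (j + 1) + s *\<^sub>R e (j + 2)" by (simp add: quarter_arc_def c_def s_def \<alpha>_def)
    have "w \<bullet> quarter_arc e j \<eta> \<le> t * \<epsilon> * exp (- 100 * \<eta> ^ 3)"
    proof -
      have rhs: "0 \<le> t * \<epsilon> * exp (- 100 * \<eta> ^ 3)" using t by (simp add: \<epsilon>_def)
      \<comment> \<open>As \<open>w\<close> lies in the span of \<open>e (m + 1)\<close> and
        \<open>e (m + 2)\<close>, only arc \<open>m\<close> and its two neighbours can meet
        it.\<close>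
      consider "j = m" | "j = m + 1" | "j + 1 = m" | "j \<noteq> m" "j \<noteq> m + 1" "j + 1 \<noteq> m" by blast
      then show ?thesis
      proof cases
        case 1
        then show ?thesis using w_arc j by simp
      next
        case 2
        have "w \<bullet> quarter_arc e j \<eta> = c * (sin (pi * (r - real m) / 2) - t * sin (pi * (\<xi> - real m) / 2))"
          unfolding w_coords arc_j unfolding 2 by (simp add: inner_add_left inner_add_right orthonormal)
        also have "\<dots> \<le> 0" using c sin_le by (intro mult_nonneg_nonpos) auto
        finally show ?thesis using rhs by linarith
      next
        case 3
        \<comment> \<open>The preceding arc meets \<open>w\<close> only through
          \<open>e (m + 1)\<close>, the start of arc \<open>m\<close>. The bound known there passes
          to smaller \<open>\<eta>\<close> because the exponential decreases.\<close>
        have wa: "w \<bullet> quarter_arc e j \<eta> = s * (w \<bullet> quarter_arc e m (real m))"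
          unfolding w_coords arc_j arc_start 3[symmetric] by (simp add: inner_add_left inner_add_right orthonormal)
        show ?thesis
        proof (cases "w \<bullet> quarter_arc e m (real m) \<le> 0")
          case True
          then show ?thesis using wa s rhs by (smt (verit) mult_nonneg_nonpos)
        next
          case False
          then have "w \<bullet> quarter_arc e j \<eta> \<le> 1 * (w \<bullet> quarter_arc e m (real m))"
            unfolding wa using s by (intro mult_right_mono) auto
          also have "\<dots> \<le> t * \<epsilon> * exp (- 100 * real m ^ 3)" using w_arc[of "real m"] by simp
          also have "\<dots> \<le> t * \<epsilon> * exp (- 100 * \<eta> ^ 3)"
            using j 3 that t by (intro mult_left_mono) (auto simp: \<epsilon>_def intro!: power_mono)
          finally show ?thesis .
        qed
      next
        case 4
        then have "w \<bullet> quarter_arc e j \<eta> = 0"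
          unfolding w_coords arc_j by (simp add: inner_add_left inner_add_right orthonormal)
        then show ?thesis using rhs by simp
      qed
    qed
    moreover have "w \<bullet> e 0 = 0"
      unfolding inner_commute[of w] by (simp add: w_def inner_diff_right e0_inner_arc)
    ultimately show ?thesis
      unfolding residual pj by (simp add: inner_diff_left inner_add_right orthonormal e0_inner_arc mult_ac)
  qed
  have eq0: "(quarter_arc e m r - t *\<^sub>R curve_point e \<xi>) \<bullet> curve_point e \<xi> = 0"
  proof -
    have arc_e0: "quarter_arc e m s \<bullet> e 0 = 0" for s
      unfolding inner_commute[of "quarter_arc e m s"] by (rule e0_inner_arc)
    have "quarter_arc e m r \<bullet> curve_point e \<xi> = quarter_arc e m \<xi> \<bullet> quarter_arc e m r"
      unfolding p inner_commute[of "quarter_arc e m \<xi>"] by (simp add: inner_add_right arc_e0)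
    moreover have "curve_point e \<xi> \<bullet> curve_point e \<xi> = 1 + \<epsilon>\<^sup>2"
      by (simp add: p inner_add_left inner_add_right orthonormal e0_inner_arc arc_e0 inner_arc power2_eq_square)
    ultimately show ?thesis
      using stationary by (simp add: inner_diff_left inner_arc \<epsilon>_def)
  qed
  \<comment> \<open>Orthogonality of the residual to its own ray turns the polar inequality into the
    obtuse angle condition.\<close>
  have "proj_on (curve_cone e) (quarter_arc e m r) = t *\<^sub>R curve_point e \<xi>"
  proof (rule proj_on_eqI)
    show "t *\<^sub>R curve_point e \<xi> \<in> curve_cone e"
      using t m\<xi> by (intro convex_cone_scaleR[OF curve_cone_convex_cone] curve_point_in_curve_cone) auto
    fix y assume "y \<in> curve_cone e"
    then have "(quarter_arc e m r - t *\<^sub>R curve_point e \<xi>) \<bullet> y \<le> 0" using le0 inner_curve_cone_le_0 by blast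
    then show "(quarter_arc e m r - t *\<^sub>R curve_point e \<xi>) \<bullet> (y - t *\<^sub>R curve_point e \<xi>) \<le> 0"
      by (simp add: inner_diff_right eq0)
  qed
  then have "partial_inverse_map e (quarter_arc e m r) = t *\<^sub>R quarter_arc e m \<xi>"
    by (simp add: partial_inverse_map_alt e0_inner_arc p inner_add_right orthonormal algebra_simps)
  then have "partial_inverse_map e (quarter_arc e m r) - quarter_arc e m \<xi> = - ((1 - t) *\<^sub>R quarter_arc e m \<xi>)"
    by (simp add: algebra_simps)
  then have "dist (partial_inverse_map e (quarter_arc e m r)) (quarter_arc e m \<xi>) = 1 - t"
    using t by (simp add: dist_norm norm_arc)
  then show thesis using that \<xi> t by simp
qed

text \<open>Here \<open>k\<close> counts the guaranteed gains that suffice to reach the last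
  \<open>1 / (50 m^2)\<close> of the arc. Nonexpansiveness carries the error of each step along
  without growth, and as these errors are bounded in proportion to the advances, they telescope to
  the first summand. The final stretch is replaced by a chord of length at most
  \<open>2 / (50 m^2)\<close>, the second summand.\<close>

lemma iterate_arc:
  assumes m: "1 \<le> m" and "real m \<le> r" "r \<le> real m + 1"
    and "real m + 1 - 1 / (50 * (real m)\<^sup>2) \<le> r + real k * exp (- 200 * (real m + 1) ^ 3)"
  shows "\<exists>N. dist ((partial_inverse_map e ^^ N) (quarter_arc e m r)) (e (m + 2))
    \<le> (real m + 1 - r) / (30 * (real m)\<^sup>2) + 1 / (25 * (real m)\<^sup>2)"
  using assms(2-)
proof (induction k arbitrary: r)
  let ?stop = "real m + 1 - 1 / (50 * (real m)\<^sup>2)"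
  have stop: "\<exists>N. dist ((partial_inverse_map e ^^ N) (quarter_arc e m r)) (e (m + 2))
      \<le> (real m + 1 - r) / (30 * (real m)\<^sup>2) + 1 / (25 * (real m)\<^sup>2)"
    if "?stop \<le> r" "r \<le> real m + 1" for r
  proof -
    have "dist (quarter_arc e m r) (quarter_arc e m (real m + 1)) \<le> 2 * \<bar>r - (real m + 1)\<bar>" by (rule dist_arc_le)
    also have "\<dots> \<le> 2 * (1 / (50 * (real m)\<^sup>2))" using that by simp
    also have "\<dots> = 1 / (25 * (real m)\<^sup>2)" by simp
    also have "\<dots> \<le> (real m + 1 - r) / (30 * (real m)\<^sup>2) + 1 / (25 * (real m)\<^sup>2)" using that by simp
    finally show ?thesis unfolding arc_end by (intro exI[of _ 0]) simp
  qed
  {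
    case 0
    then show ?case using stop by simp
  next
    case (Suc k)
    show ?case
    proof (cases "?stop \<le> r")
      case True
      then show ?thesis using stop Suc.prems by blast
    next
      case False
      then obtain \<xi> where \<xi>: "r + exp (- 200 * (real m + 1) ^ 3) \<le> \<xi>" "\<xi> < real m + 1"
        and d: "dist (partial_inverse_map e (quarter_arc e m r)) (quarter_arc e m \<xi>) \<le> (\<xi> - r) / (30 * (real m)\<^sup>2)"
        using partial_inverse_map_arc[OF m Suc.prems(1)] by (metis linear)
      have "real m \<le> \<xi>"
        using Suc.prems(1) \<xi>(1) exp_gt_zero[of "- 200 * (real m + 1) ^ 3"] by linarith
      moreover have "?stop \<le> \<xi> + real k * exp (- 200 * (real m + 1) ^ 3)"
        using Suc.prems(3) \<xi>(1) by (simp add: algebra_simps)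
      ultimately obtain N where N: "dist ((partial_inverse_map e ^^ N) (quarter_arc e m \<xi>)) (e (m + 2))
          \<le> (real m + 1 - \<xi>) / (30 * (real m)\<^sup>2) + 1 / (25 * (real m)\<^sup>2)"
        using Suc.IH[of \<xi>] \<xi>(2) by auto
      have "dist ((partial_inverse_map e ^^ Suc N) (quarter_arc e m r)) (e (m + 2))
          \<le> dist ((partial_inverse_map e ^^ N) (partial_inverse_map e (quarter_arc e m r)))
              ((partial_inverse_map e ^^ N) (quarter_arc e m \<xi>))
            + dist ((partial_inverse_map e ^^ N) (quarter_arc e m \<xi>)) (e (m + 2))"
        unfolding funpow_Suc_right o_apply by (rule dist_triangle)
      also have "\<dots> \<le> (\<xi> - r) / (30 * (real m)\<^sup>2)
          + ((real m + 1 - \<xi>) / (30 * (real m)\<^sup>2) + 1 / (25 * (real m)\<^sup>2))"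
        by (intro add_mono N order_trans[OF dist_iterate_le d])
      also have "\<dots> = (real m + 1 - r) / (30 * (real m)\<^sup>2) + 1 / (25 * (real m)\<^sup>2)"
        by (simp add: diff_divide_distrib add_divide_distrib)
      finally show ?thesis by blast
    qed
  }
qed

section \<open>From one basis vector to the next, and the lower bound on the norms\<close>

lemma iterate_basis_vector:
  assumes m: "1 \<le> m"
  shows "\<exists>N\<ge>1. dist ((partial_inverse_map e ^^ N) (e (m + 1))) (e (m + 2)) \<le> 1 / (12 * (real m)\<^sup>2)"
proof -
  \<comment> \<open>Enough guaranteed gains to cover the whole parameter length 1 of the
    arc.\<close>
  obtain k where "1 < real k * exp (- 200 * (real m + 1) ^ 3)"
    using reals_Archimedean3[of "exp (- 200 * (real m + 1) ^ 3)"] by auto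
  then have "real m + 1 - 1 / (50 * (real m)\<^sup>2) \<le> real m + real k * exp (- 200 * (real m + 1) ^ 3)"
    using zero_le_divide_1_iff[of "50 * (real m)\<^sup>2"] zero_le_power2[of "real m"] by linarith
  then obtain N where N: "dist ((partial_inverse_map e ^^ N) (e (m + 1))) (e (m + 2))
      \<le> (real m + 1 - real m) / (30 * (real m)\<^sup>2) + 1 / (25 * (real m)\<^sup>2)"
    using iterate_arc[OF m, of "real m" k] unfolding arc_start by auto
  also have "\<dots> \<le> 1 / (12 * (real m)\<^sup>2)" using m by (simp add: field_simps)
  finally have N: "dist ((partial_inverse_map e ^^ N) (e (m + 1))) (e (m + 2)) \<le> 1 / (12 * (real m)\<^sup>2)" .
  \<comment> \<open>Distinct basis vectors are at distance \<open>sqrt 2\<close>, so at least one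
    step is made. This lets the step counts grow without bound when the passages are
    chained.\<close>
  moreover have "N \<noteq> 0"
  proof
    assume "N = 0"
    then have "dist (e (m + 1)) (e (m + 2)) \<le> 1 / (12 * (real m)\<^sup>2)" using N by simp
    also have "\<dots> \<le> 1 / (12 * 1)" using m by (intro frac_le) (auto simp: one_le_power)
    finally have "(dist (e (m + 1)) (e (m + 2)))\<^sup>2 \<le> 1" by (intro power_le_one) auto
    then show False
      by (simp add: dist_norm power2_norm_eq_inner inner_diff_left inner_diff_right orthonormal)
  qed
  ultimately show ?thesis by (intro exI[of _ N]) simp
qed

text \<open>Chaining the passages adds errors \<open>1 / (12 a^2)\<close>. Since
  \<open>a + 1 \<le> 2 * a\<close>, each is at most \<open>(1 / a - 1 / (a + 1)) / 6\<close>, and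
  the bound is the telescoped sum.\<close>

lemma iterate_near_basis_vectors:
  "\<exists>N\<ge>m. dist ((partial_inverse_map e ^^ N) (e 2)) (e (m + 2)) \<le> (1 - 1 / real (m + 1)) / 6"
proof (induction m)
  case 0
  then show ?case by (intro exI[of _ 0]) (simp add: numeral_2_eq_2)
next
  case (Suc m)
  let ?T = "partial_inverse_map e"
  obtain N where N: "N \<ge> m" "dist ((?T ^^ N) (e 2)) (e (m + 2)) \<le> (1 - 1 / real (m + 1)) / 6"
    using Suc by blast
  \<comment> \<open>\<open>e (m + 2)\<close> starts arc \<open>m + 1\<close>, whose index is
    positive even for \<open>m = 0\<close>.\<close>
  obtain N' where N': "N' \<ge> 1" "dist ((?T ^^ N') (e (m + 2))) (e (m + 3)) \<le> 1 / (12 * (real (m + 1))\<^sup>2)"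
    using iterate_basis_vector[of "m + 1"] by (auto simp: numeral_eq_Suc)
  have "dist ((?T ^^ (N' + N)) (e 2)) (e (m + 3))
      \<le> dist ((?T ^^ N') ((?T ^^ N) (e 2))) ((?T ^^ N') (e (m + 2))) + dist ((?T ^^ N') (e (m + 2))) (e (m + 3))"
    unfolding funpow_add o_apply by (rule dist_triangle)
  also have "\<dots> \<le> (1 - 1 / real (m + 1)) / 6 + 1 / (12 * (real (m + 1))\<^sup>2)"
    by (intro add_mono N' order_trans[OF dist_iterate_le N(2)])
  also have "\<dots> \<le> (1 - 1 / real (Suc m + 1)) / 6"
  proof -
    define a where "a = real (m + 1)"
    have a: "1 \<le> a" by (simp add: a_def)
    have le: "1 / (12 * a\<^sup>2) \<le> (1 / a - 1 / (a + 1)) / 6"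
      using a by (simp add: divide_simps power2_eq_square)
    have eq: "real (Suc m + 1) = a + 1" by (simp add: a_def)
    have "z \<le> (p - q) / 6 \<Longrightarrow> (1 - p) / 6 + z \<le> (1 - q) / 6" for p q z :: real
      by (simp add: field_simps)
    from this[OF le] show ?thesis unfolding a_def[symmetric] eq .
  qed
  finally show ?case using N(1) N'(1) by (intro exI[of _ "N' + N"]) (auto simp: numeral_eq_Suc)
qed

text \<open>The norms decrease because the map is nonexpansive and fixes 0. It is therefore enough
  that some later iterate is within \<open>1 / 6\<close> of a unit vector.\<close>

lemma norm_iterate_ge: "5 / 6 \<le> norm ((partial_inverse_map e ^^ n) (e 2))"
proof -
  let ?y = "\<lambda>n. (partial_inverse_map e ^^ n) (e 2)"
  have "norm (?y (Suc n)) \<le> norm (?y n)" for n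
    using dist_partial_inverse_map_le[of "?y n" 0] by (simp add: partial_inverse_map_0)
  then have decr: "norm (?y N) \<le> norm (?y n)" if "n \<le> N" for N
    using that by (rule lift_Suc_antimono_le[of "\<lambda>n. norm (?y n)"])
  obtain N where N: "n \<le> N" "dist (?y N) (e (n + 2)) \<le> (1 - 1 / real (n + 1)) / 6"
    using iterate_near_basis_vectors by blast
  have "norm (e (n + 2)) \<le> norm (?y N) + dist (?y N) (e (n + 2))"
    by (metis dist_norm dist_commute norm_triangle_sub)
  moreover have "norm (e (n + 2)) = 1" by (simp add: norm_eq_sqrt_inner orthonormal)
  moreover have "(1 - 1 / real (n + 1)) / 6 \<le> 1 / 6" by simp
  ultimately show ?thesis using N decr[OF N(1)] by linarith
qed

section \<open>Coordinates in the cone and weak convergence\<close>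

lemma curve_cone_coordinate_bounds:
  assumes "y \<in> curve_cone e"
  shows "0 \<le> e k \<bullet> y" and "1 \<le> k \<Longrightarrow> e k \<bullet> y \<le> exp (100 * real k ^ 3) * (e 0 \<bullet> y)"
proof -
  have coord: "0 \<le> e k \<bullet> curve_point e \<xi> \<and>
      (1 \<le> k \<longrightarrow> e k \<bullet> curve_point e \<xi> \<le> exp (100 * real k ^ 3) * (e 0 \<bullet> curve_point e \<xi>))"
    if "0 \<le> \<xi>" for \<xi>
  proof -
    obtain j where j: "real j \<le> \<xi>" "\<xi> < real j + 1"
      and pj: "curve_point e \<xi> = exp (- 100 * \<xi> ^ 3) *\<^sub>R e 0 + quarter_arc e j \<xi>"
      using curve_point_cases[OF \<open>0 \<le> \<xi>\<close>] by metis
    define \<alpha> where "\<alpha> = pi * (\<xi> - real j) / 2"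
    define c where "c = cos \<alpha>"
    define s where "s = sin \<alpha>"
    have angle: "0 \<le> \<alpha>" "\<alpha> \<le> pi / 2" "- (pi / 2) \<le> \<alpha>" "\<alpha> \<le> pi"
      using j pi_gt_zero mult_left_mono[of "\<xi> - real j" 1 pi] unfolding \<alpha>_def
      by (auto simp: intro: order_trans[of _ 0])
    have c: "0 \<le> c" "c \<le> 1" and s: "0 \<le> s" "s \<le> 1"
      unfolding c_def s_def using angle by (auto intro!: cos_ge_zero sin_ge_zero)
    have p: "e i \<bullet> curve_point e \<xi> = (if i = 0 then exp (- 100 * \<xi> ^ 3) else 0)
        + (if i = j + 1 then c else 0) + (if i = j + 2 then s else 0)" for i
      unfolding pj by (simp add: quarter_arc_def c_def s_def \<alpha>_def inner_add_right orthonormal)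
    \<comment> \<open>For \<open>k \<ge> 1\<close>, a curve point has a component along
      \<open>e k\<close> only if \<open>\<xi> \<le> k\<close>, and then its \<open>e 0\<close>
      coefficient is at least \<open>exp (- 100 * real k ^ 3)\<close>.\<close>
    have "exp (100 * real k ^ 3) * exp (- 100 * \<xi> ^ 3) \<ge> 1" if "k = j + 1 \<or> k = j + 2"
    proof -
      have "\<xi> ^ 3 \<le> real k ^ 3" using that j \<open>0 \<le> \<xi>\<close> by (intro power_mono) auto
      then show ?thesis by (simp flip: exp_add)
    qed
    then show ?thesis unfolding p using c s by auto
  qed
  have "(- e k) \<bullet> y \<le> 0"
    by (rule inner_curve_cone_le_0[OF _ assms]) (simp add: coord)
  then show "0 \<le> e k \<bullet> y" by simp
  assume "1 \<le> k"
  then have "(e k - exp (100 * real k ^ 3) *\<^sub>R e 0) \<bullet> y \<le> 0"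
    by (intro inner_curve_cone_le_0[OF _ assms]) (simp add: coord inner_diff_left)
  then show "e k \<bullet> y \<le> exp (100 * real k ^ 3) * (e 0 \<bullet> y)" by (simp add: inner_diff_left)
qed

text \<open>Projecting \<open>p n\<close> onto the hyperplane costs
  \<open>(e 0 \<bullet> p n)\<^sup>2\<close> of the squared norm. The squared norms decrease and so
  converge, which forces \<open>e 0 \<bullet> p n\<close> to 0; the cone bounds then force the other
  coordinates of \<open>p n\<close> to 0.\<close>

lemma iterate_coordinate_tendsto_0:
  assumes "e 0 \<bullet> x = 0"
  shows "(\<lambda>n. e k \<bullet> (partial_inverse_map e ^^ n) x) \<longlonglongrightarrow> 0"
proof -
  let ?y = "\<lambda>n. (partial_inverse_map e ^^ n) x"
  define p where "p n = proj_on (curve_cone e) (?y n)" for n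
  have y0: "e 0 \<bullet> ?y n = 0" for n
    using assms by (cases n) (auto simp: e0_inner_partial_inverse_map)
  have y_Suc: "?y (Suc n) = p n - (e 0 \<bullet> p n) *\<^sub>R e 0" for n
    by (simp add: partial_inverse_map_alt y0 p_def Let_def)
  have p_in: "p n \<in> curve_cone e" for n
    unfolding p_def by (rule proj_on_in[OF curve_cone_proj])
  have "norm (p n) \<le> norm (?y n)" for n
  proof -
    have "0 \<in> curve_cone e" by (rule convex_cone_contains_0[OF curve_cone_convex_cone])
    then have "proj_on (curve_cone e) 0 = 0" by (intro proj_on_eqI) auto
    then show ?thesis
      using dist_proj_on_le[OF curve_cone_proj, of "?y n" 0] by (simp add: p_def)
  qed
  then have p_le: "(norm (p n))\<^sup>2 \<le> (norm (?y n))\<^sup>2" for n by (simp add: power_mono)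
  have y_Suc_norm: "(norm (?y (Suc n)))\<^sup>2 = (norm (p n))\<^sup>2 - (e 0 \<bullet> p n)\<^sup>2" for n
    unfolding y_Suc power2_norm_eq_inner
    by (simp add: inner_diff_left inner_diff_right inner_commute[of "p n" "e 0"] orthonormal power2_eq_square)
  have step: "(e 0 \<bullet> p n)\<^sup>2 \<le> (norm (?y n))\<^sup>2 - (norm (?y (Suc n)))\<^sup>2" for n
    using p_le[of n] unfolding y_Suc_norm by simp
  have "decseq (\<lambda>n. (norm (?y n))\<^sup>2)"
  proof (rule decseq_SucI)
    show "(norm (?y (Suc n)))\<^sup>2 \<le> (norm (?y n))\<^sup>2" for n
      using step[of n] zero_le_power2[of "e 0 \<bullet> p n"] by linarith
  qed
  then have "convergent (\<lambda>n. (norm (?y n))\<^sup>2)"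
    by (intro Bseq_monoseq_convergent decseq_bounded[of _ 0] decseq_imp_monoseq) auto
  then obtain L where "(\<lambda>n. (norm (?y n))\<^sup>2) \<longlonglongrightarrow> L" by (auto simp: convergent_def)
  then have "(\<lambda>n. (norm (?y n))\<^sup>2 - (norm (?y (Suc n)))\<^sup>2) \<longlonglongrightarrow> L - L"
    by (intro tendsto_diff LIMSEQ_Suc)
  then have "(\<lambda>n. (e 0 \<bullet> p n)\<^sup>2) \<longlonglongrightarrow> 0"
    by (intro tendsto_sandwich[where f = "\<lambda>_. 0" and h = "\<lambda>n. (norm (?y n))\<^sup>2 - (norm (?y (Suc n)))\<^sup>2"
          and g = "\<lambda>n. (e 0 \<bullet> p n)\<^sup>2"] always_eventually allI step) auto
  then have e0p: "(\<lambda>n. e 0 \<bullet> p n) \<longlonglongrightarrow> 0"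
    using power_tendsto_0_iff[of 2 "\<lambda>n. e 0 \<bullet> p n" sequentially] by simp
  show ?thesis
  proof (cases "k = 0")
    case True
    then show ?thesis by (simp add: y0)
  next
    case False
    have "(\<lambda>n. e k \<bullet> p n) \<longlonglongrightarrow> 0"
    proof (rule tendsto_sandwich[OF _ _ tendsto_const])
      show "(\<lambda>n. exp (100 * real k ^ 3) * (e 0 \<bullet> p n)) \<longlonglongrightarrow> 0"
        by (rule tendsto_mult_right_zero[OF e0p])
    qed (use curve_cone_coordinate_bounds[OF p_in] False in auto)
    then have "(\<lambda>n. e k \<bullet> ?y (Suc n)) \<longlonglongrightarrow> 0"
      using False by (simp only: y_Suc inner_diff_right inner_scaleR_right orthonormal) simp
    then show ?thesis by (rule LIMSEQ_imp_Suc)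
  qed
qed

end

text \<open>Convergence against the span extends to its closure because the uniform bound controls
  the error of approximating \<open>y\<close>.\<close>

lemma weakly_converges_to_0_if_coordinates:
  fixes X :: "nat \<Rightarrow> 'a::real_inner"
  assumes "closure (span (range e)) = UNIV" and bound: "\<And>n. norm (X n) \<le> M"
    and coords: "\<And>k. (\<lambda>n. X n \<bullet> e k) \<longlonglongrightarrow> 0"
  shows "weakly_converges_to X 0"
proof -
  have span: "(\<lambda>n. X n \<bullet> y) \<longlonglongrightarrow> 0" if "y \<in> span (range e)" for y
    using that
  proof (induction rule: span_induct_alt)
    case (step c x y)
    then obtain k where "x = e k" by blast
    then show ?case
      using tendsto_add[OF tendsto_mult_right_zero[OF coords[of k], of c] step(2)]
      by (simp add: inner_add_right)
  qed simp
  have "(\<lambda>n. X n \<bullet> y) \<longlonglongrightarrow> 0" for y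
  proof (rule LIMSEQ_I)
    fix \<epsilon> :: real assume "\<epsilon> > 0"
    have M: "0 \<le> M" using bound[of 0] norm_ge_zero[of "X 0"] by linarith
    have "y \<in> closure (span (range e))" using assms(1) by simp
    \<comment> \<open>\<open>M + 1\<close> keeps the divisor positive when
      \<open>M = 0\<close>.\<close>
    moreover have "0 < \<epsilon> / (2 * (M + 1))" using \<open>\<epsilon> > 0\<close> M by simp
    ultimately obtain z where z: "z \<in> span (range e)" "dist z y < \<epsilon> / (2 * (M + 1))"
      unfolding closure_approachable by blast
    obtain N where N: "\<And>n. n \<ge> N \<Longrightarrow> norm (X n \<bullet> z - 0) < \<epsilon> / 2"
      using LIMSEQ_D[OF span[OF z(1)], of "\<epsilon> / 2"] \<open>\<epsilon> > 0\<close> by auto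
    have "norm (X n \<bullet> y - 0) < \<epsilon>" if "n \<ge> N" for n
    proof -
      have "\<bar>X n \<bullet> (y - z)\<bar> \<le> norm (X n) * norm (y - z)" by (rule Cauchy_Schwarz_ineq2)
      also have "\<dots> \<le> (M + 1) * (\<epsilon> / (2 * (M + 1)))"
        using bound[of n] z(2) M by (intro mult_mono) (auto simp: dist_norm norm_minus_commute)
      also have "\<dots> = \<epsilon> / 2" using M by (simp add: field_simps)
      finally show ?thesis using N[OF that] unfolding inner_diff_right real_norm_def by linarith
    qed
    then show "\<exists>no. \<forall>n\<ge>no. norm (X n \<bullet> y - 0) < \<epsilon>" by blast
  qed
  then show ?thesis by (simp add: weakly_converges_to_def)
qed

theorem mainTheorem2:
  fixes e :: "nat \<Rightarrow> 'a::{real_inner, complete_space}"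
    and V K :: "'a set"
    and B :: "'a \<Rightarrow> 'a set"
    and x u :: "nat \<Rightarrow> 'a"
  assumes infinite_dimensional: "\<not> (\<exists>S::'a set. finite S \<and> span S = UNIV)"
    and separable: "separable_space (euclidean :: 'a topology)"
    and basis: "orthonormal_basis e"
    and V: "V = {e 0}\<^sup>\<bottom>"
    and K: "K = curve_cone e"
    and B: "B = proj_comp_operator V K"
    and x_0: "x 0 = e 2"
    and u_0: "u 0 = 0"
    and x_Suc: "\<And>n. x (Suc n) = proj_on V (resolvent_map B (x n + u n))"
    and u_Suc: "\<And>n. u (Suc n) = proj_on (V\<^sup>\<bottom>) (resolvent_map (setop_inverse B) (x n + u n))"
  shows "inclusion_solution V B (0, 0)
    \<and> weakly_converges_to (\<lambda>n. (x n, u n)) (0, 0)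
    \<and> \<not> (\<lambda>n. (x n, u n)) \<longlonglongrightarrow> (0, 0)"
proof -
  let ?T = "partial_inverse_map e"
  have orthonormal: "\<And>i j. e i \<bullet> e j = (if i = j then 1 else 0)"
    and dense: "closure (span (range e)) = UNIV"
    using basis by (auto simp: orthonormal_basis_def)
  have B': "B = setop_diff (setop_inverse (setop_of_map ?T)) (setop_of_map id)"
    by (simp add: B proj_comp_operator_def partial_inverse_map_def V K)
  note T_0 = partial_inverse_map_0[OF orthonormal]
    and T_V = e0_inner_partial_inverse_map[OF orthonormal]
  have V_iff: "y \<in> V \<longleftrightarrow> e 0 \<bullet> y = 0" for y
    by (simp add: V orthogonal_comp_def orthogonal_def)
  have "x n = (?T ^^ n) (e 2) \<and> u n = 0" for n
  proof (induction n)
    case (Suc n)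
    have x_V: "e 0 \<bullet> x n = 0"
      using Suc orthonormal by (cases n) (auto simp: T_V)
    \<comment> \<open>The map already takes its values in \<open>V\<close>, so the outer projection
      fixes them.\<close>
    have "x (Suc n) = ?T (x n)"
      by (simp add: x_Suc B' resolvent_map_inverse_minus_id Suc V proj_on_hyperplane[OF orthonormal] T_V)
    \<comment> \<open>Both \<open>x n\<close> and its image lie in \<open>V\<close>, so their
      difference is annihilated by the projection onto \<open>V\<^sup>\<bottom>\<close>.\<close>
    moreover have "u (Suc n) = proj_on (V\<^sup>\<bottom>) (x n - ?T (x n))"
      by (simp add: u_Suc B' resolvent_map_inverse_of_inverse_minus_id Suc)
    then have "u (Suc n) = 0"
      using x_V by (simp add: proj_on_orthogonal_comp_eq_0 V_iff inner_diff_right T_V)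
    ultimately show ?case using Suc by simp
  qed (simp add: x_0 u_0)
  then have x: "x n = (?T ^^ n) (e 2)" and u: "u n = 0" for n by auto
  have "inclusion_solution V B (0, 0)"
    by (simp add: inclusion_solution_def V_iff orthogonal_comp_def orthogonal_def
        B' in_inverse_minus_id_iff T_0)
  moreover have "weakly_converges_to x 0"
  proof (rule weakly_converges_to_0_if_coordinates[OF dense])
    fix n
    have "dist ((?T ^^ n) (e 2)) ((?T ^^ n) 0) \<le> dist (e 2) 0" by (rule dist_iterate_le[OF orthonormal])
    moreover have "(?T ^^ n) 0 = 0" by (induction n) (simp_all add: T_0)
    ultimately show "norm (x n) \<le> norm (e 2)" by (simp add: x)
  next
    show "(\<lambda>n. x n \<bullet> e k) \<longlonglongrightarrow> 0" for k
      using iterate_coordinate_tendsto_0[OF orthonormal, of "e 2" k]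
      by (simp add: x inner_commute orthonormal)
  qed
  then have "weakly_converges_to (\<lambda>n. (x n, u n)) (0, 0)"
    by (simp add: weakly_converges_to_def u)
  moreover have "\<not> (\<lambda>n. (x n, u n)) \<longlonglongrightarrow> (0, 0)"
  proof
    assume "(\<lambda>n. (x n, u n)) \<longlonglongrightarrow> (0, 0)"
    from tendsto_fst[OF this] have "x \<longlonglongrightarrow> 0" by simp
    then have "(\<lambda>n. norm (x n)) \<longlonglongrightarrow> 0" by (rule tendsto_norm_zero)
    then have "5 / 6 \<le> (0::real)"
      by (rule LIMSEQ_le_const) (use norm_iterate_ge[OF orthonormal] x in auto)
    then show False by simp
  qed
  ultimately show ?thesis by blast
qed

end
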